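(* Let $\Delta$ be a fan in $\mathbb{R}^n$ of dimension $d$ with rays $\rho_s$ generated by $v_s$, $s\in L$, and let $w\in\operatorname{MW}_d(\Delta)$. Let $p,q\in L$ be such that $\rho_p,\rho_q$ span a $2$-dimensional cone of $\Delta$, and let $\hat\Delta$ be the star subdivision of $\Delta$ at this cone, with new ray $\rho_r$ generated by $v_r=v_p+v_q$. Let $\hat w\in\operatorname{MW}_d(\hat\Delta)$ be defined by $\hat w_{\hat\sigma}=w_{\sigma}$, where $\sigma$ is the unique $d$-dimensional cone of $\Delta$ containing $\hat\sigma$. Define the operator \[D(p,q)=\frac{\partial_pe^{z\partial_q}-\partial_qe^{z\partial_p}}{\partial_p-\partial_q}=1-\sum_{m\ge 2}\frac{z^m}{m!}\sum_{\substack{a,b\ge 1\\ a+b=m}}\partial_p^a\partial_q^b,\] where $\partial_s=\partial/\partial x_s$. Then \[\operatorname{Vol}_{\hat w}(x_r,x_s)_{s\in L}=\big(D(p,q)\operatorname{Vol}_w\big)\big|_{z=x_r-x_p-x_q}.\]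
   Context: A fan in $\mathbb{R}^n$ means a pure $d$-dimensional abstract simplicial fan (equivalently a simplicial complex whose faces are the cones) with rays $\rho_s$, together with vectors $v_s\in\mathbb{R}^n$ such that the vectors of the rays of each cone are linearly independent; each cone is identified with the cone spanned by these vectors. The Stanley–Reisner ring is $\mathcal A(\Delta)=\mathbb{R}[\partial_s]/I$, $I$ generated by square-free monomials $\prod_{s\in S}\partial_s$ whose rays do not lie in a common cone; it is identified with the ring of piecewise polynomial functions, $\partial_s$ being the piecewise linear function equal to $1$ at $v_s$, $0$ at the other $v_t$. The linear parameters are $\theta_k=\sum_s (v_s)_k\partial_s$, $k=1,\ldots,n$, and the Chow ring is $\operatorname{CH}(\Delta)=\mathcal A(\Delta)/(\theta_1,\ldots,\theta_n)$. For a cone $\sigma$, $\partial_\sigma$ is the product of $\partial_s$ over the rays of $\sigma$. A Minkowski weight of degree $j$ is a vector $(w_\sigma)$ indexed by $j$-dimensional cones such that for each $(j-1)$-dimensional cone $\tau$, with $\sigma_1,\ldots,\sigma_t$ the $j$-dimensional cones containing $\tau$ and $u_k$ the generator of $\sigma_k$ not in $\tau$, the vector $\sum_k w_{\sigma_k}u_k$ lies in the span of $\tau$; these form $\operatorname{MW}_j(\Delta)$. For $w\in\operatorname{MW}_d(\Delta)$ there is a unique linear map $\phi_w:\operatorname{CH}^d(\Delta)\to\mathbb{R}$ with $\phi_w(\partial_\sigma)=w_\sigma$ for all $d$-dimensional $\sigma$, and the mixed volume $\operatorname{Vol}_w$ is the unique homogeneous degree $d$ polynomial in variables $x_s$ (one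 per ray) such that $f(\partial/\partial x_s)\operatorname{Vol}_w=\phi_w(\text{class of } f)$ for every homogeneous degree $d$ polynomial $f(\partial_s)$. The star subdivision at the cone $\tau$ spanned by $\rho_p,\rho_q$ replaces every cone $\sigma\supseteq\tau$ by the cones spanned by $\rho_r$ together with proper faces of $\sigma$ not containing $\tau$ but containing $\sigma$'s other rays, i.e. its cones are the cones of $\Delta$ not containing $\tau$ together with cones $\rho_r+\sigma'$ where $\sigma'$ does not contain $\tau$ and $\sigma'\cup\tau$ spans a cone of $\Delta$. *)

theory Defs
  imports
    "HOL-Library.Poly_Mapping"
    "HOL-Computational_Algebra.Formal_Power_Series"
    "HOL-Analysis.Finite_Cartesian_Product"
    "HOL-Algebra.QuotRing"
begin

section \<open>Real polynomials in variables indexed by a type\<close>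

text \<open>The same type serves for polynomials in the \<open>x\<^sub>s\<close> and for polynomials in the
  \<open>\<partial>\<^sub>s\<close>. The finitely supported map from \<open>'v\<close> to \<open>nat\<close> is the exponent vector of a monomial.\<close>

type_synonym 'v mpoly = "('v \<Rightarrow>\<^sub>0 nat) \<Rightarrow>\<^sub>0 real"

definition mconst :: "real \<Rightarrow> 'v mpoly"
  where "mconst c = Poly_Mapping.single 0 c"

definition mvar :: "'v \<Rightarrow> 'v mpoly"
  where "mvar s = Poly_Mapping.single (Poly_Mapping.single s 1) 1"

definition indets :: "'v mpoly \<Rightarrow> 'v set"
  where "indets f = (\<Union>m\<in>Poly_Mapping.keys f. Poly_Mapping.keys m)"

definition homogeneous :: "nat \<Rightarrow> 'v mpoly \<Rightarrow> bool"
  where "homogeneous j f \<longleftrightarrow>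
    (\<forall>m\<in>Poly_Mapping.keys f. (\<Sum>s\<in>Poly_Mapping.keys m. Poly_Mapping.lookup m s) = j)"

definition poly_ring :: "'v set \<Rightarrow> 'v mpoly ring"
  where "poly_ring L =
    \<lparr>carrier = {f. indets f \<subseteq> L}, mult = (*), one = 1, zero = 0, add = (+)\<rparr>"

definition forms :: "'v set \<Rightarrow> nat \<Rightarrow> 'v mpoly set"
  where "forms L j = {f \<in> carrier (poly_ring L). homogeneous j f}"

text \<open>In \<open>partial_deriv\<close> the subtraction of exponents is truncated, but only in terms
  whose coefficient vanishes.\<close>

definition partial_deriv :: "'v \<Rightarrow> 'v mpoly \<Rightarrow> 'v mpoly"
  where "partial_deriv s g =
    (\<Sum>m\<in>Poly_Mapping.keys g. Poly_Mapping.single (m - Poly_Mapping.single s 1)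
       (real (Poly_Mapping.lookup m s) * Poly_Mapping.lookup g m))"

definition monom_deriv :: "('v \<Rightarrow>\<^sub>0 nat) \<Rightarrow> 'v mpoly \<Rightarrow> 'v mpoly"
  where "monom_deriv m g =
    Finite_Set.fold (\<lambda>s h. (partial_deriv s ^^ Poly_Mapping.lookup m s) h) g (Poly_Mapping.keys m)"

text \<open>\<open>f(\<partial>/\<partial>x\<^sub>s) g\<close>\<close>

definition apply_diff :: "'v mpoly \<Rightarrow> 'v mpoly \<Rightarrow> 'v mpoly"
  where "apply_diff f g =
    (\<Sum>m\<in>Poly_Mapping.keys f. mconst (Poly_Mapping.lookup f m) * monom_deriv m g)"


section \<open>Fans and Minkowski weights\<close>

text \<open>Cones are represented by the index sets of their rays. As the fans are abstract, nothing
  is assumed about how the cones spanned by the generators intersect.\<close>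

record ('v, 'n::finite) fan =
  rays :: "'v set"
  cones :: "'v set set"
  gen :: "'v \<Rightarrow> real ^ 'n"

definition simplicial_fan :: "nat \<Rightarrow> ('v, 'n::finite) fan \<Rightarrow> bool"
  where "simplicial_fan d \<Delta> \<longleftrightarrow>
    finite (rays \<Delta>) \<and>
    {} \<in> cones \<Delta> \<and>
    (\<forall>s\<in>rays \<Delta>. {s} \<in> cones \<Delta>) \<and>
    (\<forall>\<sigma>\<in>cones \<Delta>. \<sigma> \<subseteq> rays \<Delta>) \<and>
    (\<forall>\<sigma>\<in>cones \<Delta>. \<forall>\<tau>. \<tau> \<subseteq> \<sigma> \<longrightarrow> \<tau> \<in> cones \<Delta>) \<and>
    (\<forall>\<sigma>\<in>cones \<Delta>. card \<sigma> \<le> d) \<and>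
    (\<forall>\<sigma>\<in>cones \<Delta>. \<exists>\<rho>\<in>cones \<Delta>. \<sigma> \<subseteq> \<rho> \<and> card \<rho> = d) \<and>
    (\<forall>\<sigma>\<in>cones \<Delta>. inj_on (gen \<Delta>) \<sigma> \<and> independent (gen \<Delta> ` \<sigma>))"

text \<open>Weights are functions on all sets of rays; only the values on \<open>j\<close>-dimensional cones matter.
  The \<open>j\<close>-dimensional cones containing \<open>\<tau>\<close> are the sets \<open>insert s \<tau>\<close>, and \<open>gen \<Delta> s\<close> is the
  generator not in \<open>\<tau>\<close>.\<close>

definition minkowski_weights :: "('v, 'n::finite) fan \<Rightarrow> nat \<Rightarrow> ('v set \<Rightarrow> real) set"
  where "minkowski_weights \<Delta> j =
    {w. \<forall>\<tau>\<in>cones \<Delta>. card \<tau> + 1 = j \<longrightarrow>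
      (\<Sum>s | s \<in> rays \<Delta> - \<tau> \<and> insert s \<tau> \<in> cones \<Delta>. w (insert s \<tau>) *\<^sub>R gen \<Delta> s)
        \<in> span (gen \<Delta> ` \<tau>)}"


section \<open>Stanley--Reisner ring, Chow ring and mixed volume\<close>

definition sr_ideal :: "('v, 'n::finite) fan \<Rightarrow> 'v mpoly set"
  where "sr_ideal \<Delta> =
    genideal (poly_ring (rays \<Delta>)) {\<Prod>s\<in>S. mvar s | S. S \<subseteq> rays \<Delta> \<and> S \<notin> cones \<Delta>}"

definition sr_ring :: "('v, 'n::finite) fan \<Rightarrow> 'v mpoly set ring"
  where "sr_ring \<Delta> = poly_ring (rays \<Delta>) Quot sr_ideal \<Delta>"

definition sr_class :: "('v, 'n::finite) fan \<Rightarrow> 'v mpoly \<Rightarrow> 'v mpoly set"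
  where "sr_class \<Delta> f = sr_ideal \<Delta> +>\<^bsub>poly_ring (rays \<Delta>)\<^esub> f"

definition theta :: "('v, 'n::finite) fan \<Rightarrow> 'n \<Rightarrow> 'v mpoly"
  where "theta \<Delta> k = (\<Sum>s\<in>rays \<Delta>. mconst (gen \<Delta> s $ k) * mvar s)"

definition theta_ideal :: "('v, 'n::finite) fan \<Rightarrow> 'v mpoly set set"
  where "theta_ideal \<Delta> = genideal (sr_ring \<Delta>) (range (\<lambda>k. sr_class \<Delta> (theta \<Delta> k)))"

definition chow_ring :: "('v, 'n::finite) fan \<Rightarrow> 'v mpoly set set ring"
  where "chow_ring \<Delta> = sr_ring \<Delta> Quot theta_ideal \<Delta>"

definition chow_class :: "('v, 'n::finite) fan \<Rightarrow> 'v mpoly \<Rightarrow> 'v mpoly set set"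
  where "chow_class \<Delta> f = theta_ideal \<Delta> +>\<^bsub>sr_ring \<Delta>\<^esub> sr_class \<Delta> f"

definition chow_part :: "('v, 'n::finite) fan \<Rightarrow> nat \<Rightarrow> 'v mpoly set set set"
  where "chow_part \<Delta> j = chow_class \<Delta> ` forms (rays \<Delta>) j"

text \<open>Real scalars act on the Chow ring through the classes of constants. Extensionality pins
  down the values outside \<open>chow_part \<Delta> d\<close>, so that uniqueness is not lost.\<close>

definition is_degree_map ::
    "nat \<Rightarrow> ('v, 'n::finite) fan \<Rightarrow> ('v set \<Rightarrow> real) \<Rightarrow> ('v mpoly set set \<Rightarrow> real) \<Rightarrow> bool"
  where "is_degree_map d \<Delta> w \<phi> \<longleftrightarrow>
    \<phi> \<in> extensional (chow_part \<Delta> d) \<and>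
    (\<forall>X\<in>chow_part \<Delta> d. \<forall>Y\<in>chow_part \<Delta> d. \<phi> (X \<oplus>\<^bsub>chow_ring \<Delta>\<^esub> Y) = \<phi> X + \<phi> Y) \<and>
    (\<forall>c. \<forall>X\<in>chow_part \<Delta> d.
      \<phi> (chow_class \<Delta> (mconst c) \<otimes>\<^bsub>chow_ring \<Delta>\<^esub> X) = c * \<phi> X) \<and>
    (\<forall>\<sigma>\<in>cones \<Delta>. card \<sigma> = d \<longrightarrow> \<phi> (chow_class \<Delta> (\<Prod>s\<in>\<sigma>. mvar s)) = w \<sigma>)"

definition degree_map ::
    "nat \<Rightarrow> ('v, 'n::finite) fan \<Rightarrow> ('v set \<Rightarrow> real) \<Rightarrow> 'v mpoly set set \<Rightarrow> real"
  where "degree_map d \<Delta> w = (THE \<phi>. is_degree_map d \<Delta> w \<phi>)"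

definition mixed_volume :: "nat \<Rightarrow> ('v, 'n::finite) fan \<Rightarrow> ('v set \<Rightarrow> real) \<Rightarrow> 'v mpoly"
  where "mixed_volume d \<Delta> w =
    (THE V. V \<in> forms (rays \<Delta>) d \<and>
      (\<forall>f\<in>forms (rays \<Delta>) d. apply_diff f V = mconst (degree_map d \<Delta> w (chow_class \<Delta> f))))"


section \<open>Star subdivision\<close>

definition star_subdivision ::
    "('v, 'n::finite) fan \<Rightarrow> 'v \<Rightarrow> 'v \<Rightarrow> 'v \<Rightarrow> ('v, 'n) fan"
  where "star_subdivision \<Delta> p q r =
    \<lparr>rays = insert r (rays \<Delta>),
     cones = {\<sigma> \<in> cones \<Delta>. \<not> {p, q} \<subseteq> \<sigma>} \<union>
             {insert r \<sigma> | \<sigma>. \<not> {p, q} \<subseteq> \<sigma> \<and> \<sigma> \<union> {p, q} \<in> cones \<Delta>},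
     gen = (gen \<Delta>)(r := gen \<Delta> p + gen \<Delta> q)\<rparr>"

text \<open>Containment of a cone of the subdivision in a cone of \<open>\<Delta>\<close>: the new ray is interior to the
  cone \<open>{p, q}\<close>, so it lies in precisely those cones of the complex that contain \<open>p\<close> and \<open>q\<close>.\<close>

definition lies_in :: "'v \<Rightarrow> 'v \<Rightarrow> 'v \<Rightarrow> 'v set \<Rightarrow> 'v set \<Rightarrow> bool"
  where "lies_in p q r \<sigma>' \<sigma> \<longleftrightarrow> \<sigma>' - {r} \<subseteq> \<sigma> \<and> (r \<in> \<sigma>' \<longrightarrow> {p, q} \<subseteq> \<sigma>)"

definition subdivided_weight ::
    "nat \<Rightarrow> ('v, 'n::finite) fan \<Rightarrow> 'v \<Rightarrow> 'v \<Rightarrow> 'v \<Rightarrow> ('v set \<Rightarrow> real) \<Rightarrow> 'v set \<Rightarrow> real"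
  where "subdivided_weight d \<Delta> p q r w \<sigma>' =
    w (THE \<sigma>. \<sigma> \<in> cones \<Delta> \<and> card \<sigma> = d \<and> lies_in p q r \<sigma>' \<sigma>)"


section \<open>The operator \<open>D(p,q)\<close>\<close>

text \<open>Operators depending on \<open>z\<close> are power series in \<open>z\<close> whose coefficients are polynomials in
  the \<open>\<partial>\<^sub>s\<close>.\<close>

definition exp_z :: "'v mpoly \<Rightarrow> 'v mpoly fps"
  where "exp_z f = Abs_fps (\<lambda>m. mconst (1 / fact m) * f ^ m)"

definition D_op :: "'v \<Rightarrow> 'v \<Rightarrow> 'v mpoly fps"
  where "D_op p q = 1 - Abs_fps (\<lambda>m. if 2 \<le> m
      then mconst (1 / fact m) * (\<Sum>(a, b) | 1 \<le> a \<and> 1 \<le> b \<and> a + b = m. mvar p ^ a * mvar q ^ b)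
      else 0)"

text \<open>First apply the operator with \<open>z\<close> as a parameter, then substitute the polynomial \<open>h\<close> for
  \<open>z\<close>. The sum has only finitely many nonzero terms if, as for \<open>D_op p q\<close>, the coefficient of
  \<open>z\<^sup>m\<close> is of order \<open>m\<close> as a differential operator.\<close>

definition apply_op_at :: "'v mpoly fps \<Rightarrow> 'v mpoly \<Rightarrow> 'v mpoly \<Rightarrow> 'v mpoly"
  where "apply_op_at F g h = Sum_any (\<lambda>m. h ^ m * apply_diff (fps_nth F m) g)"

end

theory Submission
  imports Defs "HOL-Analysis.Analysis"
begin

text \<open>The volume polynomial \<open>V\<close> of a weight \<open>w\<close> is characterised by differential equations: the
  monomials of nonfaces and the linear parameters \<open>\<theta>\<^sub>k\<close>, read as differential operators, annihilate
  \<open>V\<close>, and \<open>\<partial>\<^sub>\<sigma> V = w\<^sub>\<sigma>\<close> for the top-dimensional cones. A solution is unique because every monomial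
  can be moved to square-free ones modulo the relations. It exists for a Minkowski weight because the
  weights of all degrees form a module over the polynomials in the \<open>\<partial>\<^sub>s\<close> on which the relations act
  by zero, and \<open>V\<close> is obtained from the action by integrating along Euler's identity. Conversely, a
  weight for which a solution exists is balanced.

  It therefore suffices to check the equations of the subdivision for \<open>R = (D V)\<close> at
  \<open>z = x\<^sub>r - x\<^sub>p - x\<^sub>q\<close>. By the chain rule, \<open>\<partial>\<^sub>r\<close> acts on \<open>R\<close> as \<open>\<partial>\<^sub>z D\<close> acts on \<open>V\<close>, and
  \<open>\<partial>\<^sub>p\<close> as \<open>\<partial>\<^sub>p D - \<partial>\<^sub>z D\<close>. The linear equations follow at once, \<open>\<partial>\<^sub>p \<partial>\<^sub>q R = 0\<close> is the identity
  \<open>(\<partial>\<^sub>z - \<partial>\<^sub>p)(\<partial>\<^sub>z - \<partial>\<^sub>q) D = 0\<close>, and the other nonfaces and the cones are reduced to those of the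
  original fan since \<open>\<partial>\<^sub>p \<partial>\<^sub>q\<close> divides \<open>\<partial>\<^sub>z D\<close>.\<close>

section \<open>Differential operators on polynomials\<close>

abbreviation lookup :: "('a \<Rightarrow>\<^sub>0 'b::zero) \<Rightarrow> 'a \<Rightarrow> 'b" where "lookup \<equiv> Poly_Mapping.lookup"
abbreviation keys :: "('a \<Rightarrow>\<^sub>0 'b::zero) \<Rightarrow> 'a set" where "keys \<equiv> Poly_Mapping.keys"
abbreviation single :: "'a \<Rightarrow> 'b \<Rightarrow> ('a \<Rightarrow>\<^sub>0 'b::zero)" where "single \<equiv> Poly_Mapping.single"

lemma sum_single_lookup:
  fixes f :: "'a \<Rightarrow>\<^sub>0 'b::comm_monoid_add"
  assumes "finite A" "keys f \<subseteq> A"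
  shows "(\<Sum>k\<in>A. single k (lookup f k)) = f"
proof (rule poly_mapping_eqI)
  fix k
  have "lookup (\<Sum>k\<in>A. single k (lookup f k)) k = (\<Sum>k'\<in>A. if k' = k then lookup f k else 0)"
    by (auto simp: lookup_sum lookup_single when_def intro!: sum.cong)
  also have "\<dots> = lookup f k"
    using assms by (auto simp: in_keys_iff)
  finally show "lookup (\<Sum>k\<in>A. single k (lookup f k)) k = lookup f k" .
qed

lemma poly_mapping_additive_induct [case_names single add]:
  fixes f :: "'a \<Rightarrow>\<^sub>0 'b::comm_monoid_add"
  assumes "\<And>k c. P (single k c)" and "\<And>f g. P f \<Longrightarrow> P g \<Longrightarrow> P (f + g)"
  shows "P f"
proof -
  \<comment> \<open>The empty sum is covered because \<open>single undefined 0\<close> is the zero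
    map.\<close>
  have "P (\<Sum>k\<in>A. single k (lookup f k))" if "finite A" for A
    using that by induction (use assms assms(1)[of undefined 0] in auto)
  then show ?thesis
    using sum_single_lookup[of "keys f" f] by (metis finite_keys order_refl)
qed

lemma lookup_mconst_mult [simp]: "lookup (mconst c * f) m = c * lookup f m"
  unfolding mconst_def mult_map_scale_conv_mult[symmetric]
  by (simp add: Poly_Mapping.map.rep_eq when_def)

lemma lookup_mconst: "lookup (mconst c) m = (if m = 0 then c else 0)"
  by (auto simp: mconst_def lookup_single when_def)

lemma mconst_0 [simp]: "mconst 0 = 0" and mconst_1 [simp]: "mconst 1 = 1"
  by (simp_all add: mconst_def)

lemma mconst_add: "mconst (a + b) = mconst a + mconst b"
  by (simp add: mconst_def single_add)

lemma mconst_mult: "mconst (a * b) = mconst a * mconst b"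
  by (simp add: mconst_def mult_single)

lemma mconst_sum: "mconst (\<Sum>i\<in>I. f i) = (\<Sum>i\<in>I. mconst (f i))"
  by (induction I rule: infinite_finite_induct) (simp_all add: mconst_add)

lemma mconst_eq_0_iff: "mconst c = 0 \<longleftrightarrow> c = 0"
  by (metis lookup_mconst lookup_zero mconst_0)

lemma lookup_partial_deriv:
  "lookup (partial_deriv s g) m = (real (lookup m s) + 1) * lookup g (m + single s 1)"
proof -
  \<comment> \<open>Lowering the exponent of \<open>s\<close> is injective only on monomials
    divisible by \<open>s\<close>; every other term of the sum carries the factor
    \<open>lookup k s = 0\<close>.\<close>
  have *: "k - single s 1 = m \<longleftrightarrow> k = m + single s 1" if "lookup k s \<noteq> 0" for k :: "'a \<Rightarrow>\<^sub>0 nat"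
  proof
    assume "k - single s 1 = m"
    then have "lookup m t = lookup k t - lookup (single s 1) t" for t
      by (auto simp: lookup_minus)
    then show "k = m + single s 1"
      using that by (intro poly_mapping_eqI) (auto simp: lookup_add lookup_single when_def)
  qed simp
  have "lookup (partial_deriv s g) m =
      (\<Sum>k\<in>keys g. if k = m + single s 1 then (real (lookup m s) + 1) * lookup g (m + single s 1) else 0)"
    unfolding partial_deriv_def lookup_sum lookup_single
    by (intro sum.cong refl) (use * in \<open>auto simp: when_def lookup_add\<close>)
  also have "\<dots> = (real (lookup m s) + 1) * lookup g (m + single s 1)"
    by (auto simp: in_keys_iff)
  finally show ?thesis .
qed

lemma partial_deriv_add: "partial_deriv s (f + g) = partial_deriv s f + partial_deriv s g"
  by (rule poly_mapping_eqI) (simp add: lookup_partial_deriv lookup_add algebra_simps)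

lemma partial_deriv_0 [simp]: "partial_deriv s 0 = 0"
  by (rule poly_mapping_eqI) (simp add: lookup_partial_deriv)

lemma partial_deriv_diff: "partial_deriv s (f - g) = partial_deriv s f - partial_deriv s g"
  by (rule poly_mapping_eqI) (simp add: lookup_partial_deriv lookup_minus algebra_simps)

lemma partial_deriv_sum: "partial_deriv s (\<Sum>i\<in>I. f i) = (\<Sum>i\<in>I. partial_deriv s (f i))"
  by (induction I rule: infinite_finite_induct) (simp_all add: partial_deriv_add)

lemma partial_deriv_single:
  "partial_deriv s (single m c) = single (m - single s 1) (real (lookup m s) * c)"
  by (simp add: partial_deriv_def)

lemma partial_deriv_mult: "partial_deriv s (f * g) = partial_deriv s f * g + f * partial_deriv s g"
proof (induction f rule: poly_mapping_additive_induct)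
  case (single m a)
  show ?case
  proof (induction g rule: poly_mapping_additive_induct)
    case (single n b)
    have 1: "m + n - single s 1 = m - single s 1 + n" if "lookup m s \<noteq> 0"
      using that by (intro poly_mapping_eqI) (auto simp: lookup_add lookup_minus lookup_single when_def)
    have 2: "m + n - single s 1 = m + (n - single s 1)" if "lookup n s \<noteq> 0"
      using that by (intro poly_mapping_eqI) (auto simp: lookup_add lookup_minus lookup_single when_def)
    have "partial_deriv s (single m a * single n b) =
        single (m + n - single s 1) (real (lookup m s) * a * b) +
        single (m + n - single s 1) (a * (real (lookup n s) * b))"
      by (simp add: mult_single partial_deriv_single lookup_add algebra_simps flip: single_add)
    also have "single (m + n - single s 1) (real (lookup m s) * a * b) =
        partial_deriv s (single m a) * single n b"
      by (cases "lookup m s = 0") (simp_all add: mult_single partial_deriv_single 1 del: One_nat_def)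
    also have "single (m + n - single s 1) (a * (real (lookup n s) * b)) =
        single m a * partial_deriv s (single n b)"
      by (cases "lookup n s = 0") (simp_all add: mult_single partial_deriv_single 2 del: One_nat_def)
    finally show ?case .
  qed (simp add: partial_deriv_add algebra_simps)
qed (simp add: partial_deriv_add algebra_simps)

lemma partial_deriv_mconst [simp]: "partial_deriv s (mconst c) = 0"
  by (simp add: mconst_def partial_deriv_single)

lemma partial_deriv_1 [simp]: "partial_deriv s 1 = 0"
  by (metis mconst_1 partial_deriv_mconst)

lemma partial_deriv_mvar: "partial_deriv s (mvar t) = (if s = t then 1 else 0)"
  by (simp add: mvar_def partial_deriv_single lookup_single)

lemma partial_deriv_power:
  "partial_deriv s (f ^ Suc m) = mconst (real (Suc m)) * f ^ m * partial_deriv s f"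
proof (induction m)
  case (Suc m)
  have "partial_deriv s (f ^ Suc (Suc m)) =
      partial_deriv s f * f ^ Suc m + f * partial_deriv s (f ^ Suc m)"
    by (simp add: partial_deriv_mult)
  also have "\<dots> = (1 + mconst (real (Suc m))) * f ^ Suc m * partial_deriv s f"
    unfolding Suc.IH by (simp add: algebra_simps)
  also have "1 + mconst (real (Suc m)) = mconst (real (Suc (Suc m)))"
    by (metis mconst_1 mconst_add of_nat_Suc)
  finally show ?case .
qed simp

lemma lookup_partial_deriv_funpow:
  "lookup ((partial_deriv s ^^ n) g) m = pochhammer (real (lookup m s) + 1) n * lookup g (m + single s n)"
proof (induction n arbitrary: m)
  case (Suc n)
  then show ?case
    by (simp add: lookup_partial_deriv lookup_add pochhammer_rec add_ac flip: single_add)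
qed simp

text \<open>Later identities for \<open>monom_deriv\<close> are checked on coefficients through this
  formula. The index set \<open>A\<close> may exceed \<open>keys k\<close>, the extra factors being
  1, so that the products for \<open>k\<close>, \<open>l\<close> and \<open>k + l\<close> can be
  taken over one set.\<close>

lemma lookup_monom_deriv:
  assumes "finite A" "keys k \<subseteq> A"
  shows "lookup (monom_deriv k g) m =
    (\<Prod>s\<in>A. pochhammer (real (lookup m s) + 1) (lookup k s)) * lookup g (m + k)"
proof -
  \<comment> \<open>Partial derivatives commute, so the fold in \<open>monom_deriv\<close> does not
    depend on the order of the variables.\<close>
  interpret comp_fun_commute "\<lambda>s h. (partial_deriv s ^^ lookup k s) h"
  proof
    fix s t
    show "(\<lambda>h. (partial_deriv t ^^ lookup k t) h) \<circ> (\<lambda>h. (partial_deriv s ^^ lookup k s) h) =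
        (\<lambda>h. (partial_deriv s ^^ lookup k s) h) \<circ> (\<lambda>h. (partial_deriv t ^^ lookup k t) h)"
      by (cases "s = t", simp, intro ext poly_mapping_eqI)
        (simp add: lookup_partial_deriv_funpow lookup_add lookup_single add_ac)
  qed
  have "lookup (Finite_Set.fold (\<lambda>s h. (partial_deriv s ^^ lookup k s) h) g B) m =
      (\<Prod>s\<in>B. pochhammer (real (lookup m s) + 1) (lookup k s)) *
        lookup g (m + (\<Sum>s\<in>B. single s (lookup k s)))" if "finite B" for B
    using that
  proof (induction B arbitrary: m)
    case (insert s B)
    have "lookup (single s (lookup k s)) t = 0" if "t \<in> B" for t
      using that insert.hyps by (auto simp: lookup_single when_def)
    then have "(\<Prod>t\<in>B. pochhammer (real (lookup (m + single s (lookup k s)) t) + 1) (lookup k t)) =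
        (\<Prod>t\<in>B. pochhammer (real (lookup m t) + 1) (lookup k t))"
      by (intro prod.cong) (auto simp: lookup_add)
    then show ?case
      using insert.hyps by (simp add: insert.IH lookup_partial_deriv_funpow add.assoc)
  qed simp
  note this[OF finite_keys, of k]
  moreover have "(\<Prod>s\<in>keys k. pochhammer (real (lookup m s) + 1) (lookup k s)) =
      (\<Prod>s\<in>A. pochhammer (real (lookup m s) + 1) (lookup k s))"
    using assms by (intro prod.mono_neutral_left) (auto simp: in_keys_iff)
  ultimately show ?thesis
    by (simp add: monom_deriv_def sum_single_lookup)
qed

lemma monom_deriv_0 [simp]: "monom_deriv 0 g = g"
  by (simp add: monom_deriv_def)

lemma monom_deriv_plus: "monom_deriv (k + l) g = monom_deriv k (monom_deriv l g)"
proof (rule poly_mapping_eqI)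
  fix m
  let ?A = "keys k \<union> keys l"
  have sub: "keys k \<subseteq> ?A" "keys l \<subseteq> ?A" "keys (k + l) \<subseteq> ?A" "finite ?A"
    using keys_add[of k l] by auto
  show "lookup (monom_deriv (k + l) g) m = lookup (monom_deriv k (monom_deriv l g)) m"
    by (simp add: lookup_monom_deriv[OF sub(4) sub(1)] lookup_monom_deriv[OF sub(4) sub(2)]
        lookup_monom_deriv[OF sub(4) sub(3)] lookup_add pochhammer_product' prod.distrib add_ac)
qed

lemma monom_deriv_commute: "monom_deriv k (monom_deriv l g) = monom_deriv l (monom_deriv k g)"
  by (metis add.commute monom_deriv_plus)

lemma monom_deriv_single: "monom_deriv (single s 1) g = partial_deriv s g"
proof (rule poly_mapping_eqI)
  fix m
  have "lookup (monom_deriv (single s 1) g) m =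
      (\<Prod>t\<in>{s}. pochhammer (real (lookup m t) + 1) (lookup (single s 1) t)) * lookup g (m + single s 1)"
    by (rule lookup_monom_deriv) auto
  then show "lookup (monom_deriv (single s 1) g) m = lookup (partial_deriv s g) m"
    by (simp add: lookup_partial_deriv)
qed

lemma monom_deriv_add: "monom_deriv k (f + g) = monom_deriv k f + monom_deriv k g"
  by (rule poly_mapping_eqI)
    (simp add: lookup_monom_deriv[OF finite_keys order_refl] lookup_add algebra_simps)

lemma monom_deriv_mconst_mult: "monom_deriv k (mconst c * g) = mconst c * monom_deriv k g"
  by (rule poly_mapping_eqI) (simp add: lookup_monom_deriv[OF finite_keys order_refl])

lemma monom_deriv_zero [simp]: "monom_deriv k 0 = 0"
  by (rule poly_mapping_eqI) (simp add: lookup_monom_deriv[OF finite_keys order_refl])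

section \<open>Polynomials acting as differential operators with constant coefficients\<close>

lemma apply_diff_single: "apply_diff (single k c) g = mconst c * monom_deriv k g"
  by (simp add: apply_diff_def)

lemma apply_diff_add_left: "apply_diff (f + f') g = apply_diff f g + apply_diff f' g"
  unfolding apply_diff_def
  by (rule setsum_keys_plus_distrib) (simp_all add: mconst_add algebra_simps)

lemma apply_diff_0_left [simp]: "apply_diff 0 g = 0"
  by (simp add: apply_diff_def)

lemma apply_diff_uminus_left: "apply_diff (- f) g = - apply_diff f g"
  using apply_diff_add_left[of f "- f" g] by (simp add: eq_neg_iff_add_eq_0 add.commute)

lemma apply_diff_diff_left: "apply_diff (f - f') g = apply_diff f g - apply_diff f' g"
  using apply_diff_add_left[of f "- f'" g] by (simp add: apply_diff_uminus_left)

lemma apply_diff_sum_left: "apply_diff (\<Sum>i\<in>I. f i) g = (\<Sum>i\<in>I. apply_diff (f i) g)"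
  by (induction I rule: infinite_finite_induct) (simp_all add: apply_diff_add_left)

lemma apply_diff_add_right: "apply_diff f (g + g') = apply_diff f g + apply_diff f g'"
  by (simp add: apply_diff_def monom_deriv_add sum.distrib algebra_simps)

lemma apply_diff_0_right [simp]: "apply_diff f 0 = 0"
  by (simp add: apply_diff_def)

lemma apply_diff_sum_right: "apply_diff f (\<Sum>i\<in>I. g i) = (\<Sum>i\<in>I. apply_diff f (g i))"
  by (induction I rule: infinite_finite_induct) (simp_all add: apply_diff_add_right)

lemma apply_diff_1 [simp]: "apply_diff 1 g = g"
  using apply_diff_single[of 0 1 g] by simp

lemma apply_diff_mconst: "apply_diff (mconst c) g = mconst c * g"
  using apply_diff_single[of 0 c g] by (simp add: mconst_def)

lemma apply_diff_mvar: "apply_diff (mvar s) g = partial_deriv s g"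
  unfolding mvar_def apply_diff_single monom_deriv_single by simp

text \<open>This makes polynomials in the \<open>x\<^sub>s\<close> a module over polynomials in the
  \<open>\<partial>\<^sub>s\<close>. By bilinearity both factors may be taken to be single terms,
  where it is \<open>monom_deriv_plus\<close>.\<close>

lemma apply_diff_mult: "apply_diff (f * f') g = apply_diff f (apply_diff f' g)"
proof (induction f rule: poly_mapping_additive_induct)
  case (single k a)
  show ?case
    by (induction f' rule: poly_mapping_additive_induct)
      (simp_all add: mult_single apply_diff_single monom_deriv_plus monom_deriv_mconst_mult
        monom_deriv_add monom_deriv_commute mconst_mult mult_ac ring_distribs apply_diff_add_left)
qed (simp add: apply_diff_add_left algebra_simps)

lemma apply_diff_mult': "apply_diff (f * f') g = apply_diff f' (apply_diff f g)"
  by (metis apply_diff_mult mult.commute)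

subsection \<open>Homogeneous polynomials\<close>

definition mdeg :: "('v \<Rightarrow>\<^sub>0 nat) \<Rightarrow> nat" where "mdeg m = (\<Sum>s\<in>keys m. lookup m s)"

lemma mdeg_superset: "finite A \<Longrightarrow> keys m \<subseteq> A \<Longrightarrow> mdeg m = (\<Sum>s\<in>A. lookup m s)"
  unfolding mdeg_def by (rule sum.mono_neutral_left) (auto simp: in_keys_iff)

lemma mdeg_add [simp]: "mdeg (k + l) = mdeg k + mdeg l"
proof -
  have "finite (keys k \<union> keys l)" "keys (k + l) \<subseteq> keys k \<union> keys l"
    using keys_add[of k l] by auto
  then show ?thesis
    by (simp add: mdeg_superset[of "keys k \<union> keys l"] lookup_add sum.distrib)
qed

lemma mdeg_0 [simp]: "mdeg 0 = 0" and mdeg_single [simp]: "mdeg (single s n) = n"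
  by (simp_all add: mdeg_def)

lemma mdeg_eq_0_iff: "mdeg m = 0 \<longleftrightarrow> m = 0"
  by (auto simp: mdeg_def in_keys_iff poly_mapping_eq_iff fun_eq_iff)

text \<open>Every nontrivial derivative kills a constant. This later evaluates operators on
  top-dimensional cones, where the derivative of the volume polynomial is already constant.\<close>

lemma apply_diff_of_mconst: "apply_diff f (mconst c) = mconst (c * lookup f 0)"
proof (induction f rule: poly_mapping_additive_induct)
  case (single k a)
  have "lookup (monom_deriv k (mconst c)) m = (if k = 0 \<and> m = 0 then c else 0)" for m
  proof -
    have "m + k = 0 \<longleftrightarrow> m = 0 \<and> k = 0"
      by (metis add_is_0 mdeg_add mdeg_eq_0_iff)
    then show ?thesis
      by (auto simp: lookup_monom_deriv[OF finite_keys order_refl] lookup_mconst)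
  qed
  then show ?case
    by (intro poly_mapping_eqI) (auto simp: apply_diff_single lookup_mconst lookup_single when_def)
qed (simp add: apply_diff_add_left lookup_add mconst_add algebra_simps)

lemma keys_add_nat: "keys (k + l) = keys k \<union> keys (l :: 'v \<Rightarrow>\<^sub>0 nat)"
  by (auto simp: in_keys_iff lookup_add)

lemma forms_iff: "f \<in> forms L j \<longleftrightarrow> (\<forall>m. lookup f m \<noteq> 0 \<longrightarrow> keys m \<subseteq> L \<and> mdeg m = j)"
  unfolding forms_def poly_ring_def indets_def homogeneous_def mdeg_def in_keys_iff[symmetric]
  by auto

lemma formsD:
  assumes "f \<in> forms L j" "lookup f m \<noteq> 0"
  shows "keys m \<subseteq> L" "mdeg m = j"
  using assms by (auto simp: forms_iff)

lemma forms_0 [simp]: "0 \<in> forms L j"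
  by (simp add: forms_iff)

lemma forms_add: "f \<in> forms L j \<Longrightarrow> g \<in> forms L j \<Longrightarrow> f + g \<in> forms L j"
  unfolding forms_iff lookup_add by (metis add.right_neutral)

lemma forms_uminus: "f \<in> forms L j \<Longrightarrow> - f \<in> forms L j"
  by (auto simp: forms_iff)

lemma forms_diff: "f \<in> forms L j \<Longrightarrow> g \<in> forms L j \<Longrightarrow> f - g \<in> forms L j"
  using forms_add[of f L j "- g"] by (simp add: forms_uminus)

lemma forms_sum: "(\<And>i. i \<in> I \<Longrightarrow> f i \<in> forms L j) \<Longrightarrow> (\<Sum>i\<in>I. f i) \<in> forms L j"
  by (induction I rule: infinite_finite_induct) (simp_all add: forms_add)

lemma forms_mult:
  assumes "f \<in> forms L i" "g \<in> forms L j"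
  shows "f * g \<in> forms L (i + j)"
proof -
  have "keys m \<subseteq> L \<and> mdeg m = i + j" if m: "m \<in> keys (f * g)" for m
  proof -
    obtain a b where "m = a + b" "a \<in> keys f" "b \<in> keys g"
      using subsetD[OF keys_mult m] by blast
    then show ?thesis
      using formsD[OF assms(1), of a] formsD[OF assms(2), of b] by (simp add: in_keys_iff keys_add_nat)
  qed
  then show ?thesis
    by (simp add: forms_iff in_keys_iff)
qed

lemma forms_single: "keys m \<subseteq> L \<Longrightarrow> mdeg m = j \<Longrightarrow> single m c \<in> forms L j"
  by (auto simp: forms_iff lookup_single when_def)

lemma forms_mvar: "s \<in> L \<Longrightarrow> mvar s \<in> forms L 1"
  unfolding mvar_def by (rule forms_single) simp_all

lemma forms_mconst: "mconst c \<in> forms L 0"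
  unfolding mconst_def by (rule forms_single) simp_all

lemma forms_mconst_mult: "f \<in> forms L j \<Longrightarrow> mconst c * f \<in> forms L j"
  using forms_mult[OF forms_mconst] by fastforce

lemma forms_power: "f \<in> forms L j \<Longrightarrow> f ^ n \<in> forms L (n * j)"
proof (induction n)
  case 0
  then show ?case
    using forms_mconst[of 1 L] by simp
next
  case (Suc n)
  then show ?case
    using forms_mult[of f L j "f ^ n" "n * j"] by simp
qed

lemma forms_prod_mvar: "S \<subseteq> L \<Longrightarrow> (\<Prod>s\<in>S. mvar s) \<in> forms L (card S)"
proof (induction S rule: infinite_finite_induct)
  case (insert s S)
  then show ?case
    using forms_mult[OF forms_mvar[of s L], of "\<Prod>s\<in>S. mvar s" "card S"] by simp
qed (use forms_mconst[of 1 L] in simp_all)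

lemma forms_mono: "L \<subseteq> L' \<Longrightarrow> forms L j \<subseteq> forms L' j"
  unfolding forms_iff subset_iff by blast

lemma forms_degree_0: "f \<in> forms L 0 \<Longrightarrow> f = mconst (lookup f 0)"
  by (intro poly_mapping_eqI) (auto simp: forms_iff lookup_mconst mdeg_eq_0_iff)

lemma forms_monom_deriv:
  assumes "g \<in> forms L (mdeg k + j)"
  shows "monom_deriv k g \<in> forms L j"
proof -
  have "keys m \<subseteq> L \<and> mdeg m = j" if "lookup (monom_deriv k g) m \<noteq> 0" for m
  proof -
    have "lookup g (m + k) \<noteq> 0"
      using that by (auto simp: lookup_monom_deriv[OF finite_keys order_refl])
    then show ?thesis
      using formsD[OF assms, of "m + k"] by (simp add: keys_add_nat)
  qed
  then show ?thesis
    by (simp add: forms_iff)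
qed

lemma monom_deriv_high:
  assumes "g \<in> forms L j" "j < mdeg k"
  shows "monom_deriv k g = 0"
proof (rule poly_mapping_eqI)
  fix m
  have "lookup g (m + k) = 0"
    using formsD(2)[OF assms(1), of "m + k"] assms(2) by auto
  then show "lookup (monom_deriv k g) m = lookup 0 m"
    by (simp add: lookup_monom_deriv[OF finite_keys order_refl])
qed

lemma forms_apply_diff:
  assumes "f \<in> forms L' i" "g \<in> forms L (i + j)"
  shows "apply_diff f g \<in> forms L j"
  unfolding apply_diff_def
proof (intro forms_sum forms_mconst_mult forms_monom_deriv)
  fix m
  assume "m \<in> keys f"
  then show "g \<in> forms L (mdeg m + j)"
    using assms formsD(2)[of f L' i m] by (simp add: in_keys_iff)
qed

lemma apply_diff_high:
  assumes "\<And>m. m \<in> keys f \<Longrightarrow> j < mdeg m" "g \<in> forms L j"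
  shows "apply_diff f g = 0"
  unfolding apply_diff_def using assms by (intro sum.neutral) (auto simp: monom_deriv_high)

lemma forms_apply_diff_const:
  assumes "f \<in> forms L' j" "g \<in> forms L j"
  shows "apply_diff f g = mconst (lookup (apply_diff f g) 0)"
  using forms_apply_diff[of f L' j g L 0] assms by (intro forms_degree_0) auto

text \<open>The pairing of forms of equal degree by differentiation is nondegenerate: the operator
  of a monomial \<open>m\<close> extracts the coefficient of \<open>m\<close> times the product of
  the factorials of its exponents.\<close>

lemma apply_diff_forms_unique:
  assumes "V \<in> forms L d" "W \<in> forms L d"
    and "\<And>f. f \<in> forms L d \<Longrightarrow> apply_diff f V = apply_diff f W"
  shows "V = W"
proof (rule poly_mapping_eqI)
  fix m
  show "lookup V m = lookup W m"
  proof (cases "lookup V m = 0 \<and> lookup W m = 0")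
    case False
    then have "single m 1 \<in> forms L d"
      using assms(1,2) by (intro forms_single) (auto simp: forms_iff)
    then have "monom_deriv m V = monom_deriv m W"
      using assms(3) by (metis apply_diff_single mconst_1 mult_1)
    then have "lookup (monom_deriv m V) 0 = lookup (monom_deriv m W) 0"
      by simp
    then show ?thesis
      by (simp add: lookup_monom_deriv[OF finite_keys order_refl] pochhammer_fact[symmetric])
  qed simp
qed

section \<open>Minkowski weights and volume polynomials\<close>

text \<open>A bridge between the encoding in fans, injectivity plus independence of an image set,
  and relations with coefficients indexed by rays.\<close>

lemma inj_independent_iff:
  fixes g :: "'v \<Rightarrow> 'a::real_vector"
  assumes "finite A"
  shows "inj_on g A \<and> independent (g ` A) \<longleftrightarrow>
    (\<forall>c. (\<Sum>s\<in>A. c s *\<^sub>R g s) = 0 \<longrightarrow> (\<forall>s\<in>A. c s = 0))" (is "?l \<longleftrightarrow> ?r")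
proof
  assume l: ?l
  show ?r
  proof (intro allI impI ballI)
    fix c s
    assume c: "(\<Sum>s\<in>A. c s *\<^sub>R g s) = 0" and s: "s \<in> A"
    have "(\<Sum>x\<in>g ` A. c (the_inv_into A g x) *\<^sub>R x) = (\<Sum>s\<in>A. c s *\<^sub>R g s)"
      using l by (simp add: sum.reindex the_inv_into_f_f)
    then have "c (the_inv_into A g (g s)) = 0"
      using l s c assms by (intro independentD[of "g ` A" "g ` A"]) auto
    then show "c s = 0"
      using l s by (simp add: the_inv_into_f_f)
  qed
next
  assume r: ?r
  have inj: "inj_on g A"
  proof (rule inj_onI, rule ccontr)
    fix s t
    assume st: "s \<in> A" "t \<in> A" "g s = g t" "s \<noteq> t"
    let ?c = "\<lambda>u. if u = s then 1 else if u = t then -1 else 0 :: real"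
    have "(\<Sum>u\<in>A. ?c u *\<^sub>R g u) = (\<Sum>u\<in>A. (if u = s then g s else 0) - (if u = t then g t else 0))"
      using st by (intro sum.cong) auto
    also have "\<dots> = 0"
      using st assms by (simp add: sum_subtractf)
    finally show False
      using r st by (auto dest!: spec[of _ ?c])
  qed
  have "independent (g ` A)"
  proof (rule independent_if_scalars_zero)
    fix f x
    assume "(\<Sum>x\<in>g ` A. f x *\<^sub>R x) = 0" "x \<in> g ` A"
    then show "f x = 0"
      using r inj by (auto simp: sum.reindex)
  qed (use assms in simp)
  with inj show ?l ..
qed

text \<open>These assumptions carry the uniqueness arguments and are what is verified for the star
  subdivision. Closure under faces is added in \<open>simplicial_linear_complex\<close>, where
  volume polynomials are constructed.\<close>

locale linear_complex =
  fixes L :: "'v set" and K :: "'v set set" and v :: "'v \<Rightarrow> real ^ 'n::finite"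
  assumes finite_rays: "finite L"
    and cone_subset: "\<sigma> \<in> K \<Longrightarrow> \<sigma> \<subseteq> L"
    and cone_inj: "\<sigma> \<in> K \<Longrightarrow> inj_on v \<sigma>"
    and cone_independent: "\<sigma> \<in> K \<Longrightarrow> independent (v ` \<sigma>)"
begin

lemma finite_cone: "\<sigma> \<in> K \<Longrightarrow> finite \<sigma>"
  using cone_subset finite_rays finite_subset by blast

lemma dual_functional:
  assumes "\<rho> \<in> K"
  shows "\<exists>l. linear l \<and> (\<forall>t\<in>\<rho>. l (v t) = (if t = s then 1 else 0 :: real))"
proof -
  let ?f = "\<lambda>x. if the_inv_into \<rho> v x = s then 1 else 0 :: real"
  obtain l where l: "linear l" "\<forall>x\<in>v ` \<rho>. l x = ?f x"
    using linear_independent_extend[OF cone_independent[OF assms], of ?f] by (elim exE conjE)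
  have "l (v t) = (if t = s then 1 else 0)" if "t \<in> \<rho>" for t
    using l(2) that the_inv_into_f_f[OF cone_inj[OF assms] that] by simp
  with l(1) show ?thesis by blast
qed

text \<open>A linear relation among all generators whose coefficients off \<open>\<rho>\<close> are
  prescribed by \<open>w\<close>; its coefficients on \<open>\<rho>\<close> are the new information.
  Prescribing also the values outside \<open>L\<close> makes \<open>a\<close> unique as a
  function.\<close>

definition balanced :: "('v set \<Rightarrow> real) \<Rightarrow> 'v set \<Rightarrow> ('v \<Rightarrow> real) \<Rightarrow> bool"
  where "balanced w \<rho> a \<longleftrightarrow>
    (\<forall>u. u \<notin> \<rho> \<longrightarrow> a u = w (insert u \<rho>)) \<and> (\<Sum>u\<in>L. a u *\<^sub>R v u) = 0"

lemma balanced_unique: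
  assumes "\<rho> \<in> K" "balanced w \<rho> a" "balanced w \<rho> b"
  shows "a = b"
proof
  fix u
  show "a u = b u"
  proof (cases "u \<in> \<rho>")
    case True
    have "(\<Sum>u\<in>L. (a u - b u) *\<^sub>R v u) = 0"
      using assms(2,3) by (simp add: balanced_def scaleR_diff_left sum_subtractf)
    moreover have "(\<Sum>u\<in>\<rho>. (a u - b u) *\<^sub>R v u) = (\<Sum>u\<in>L. (a u - b u) *\<^sub>R v u)"
      using assms cone_subset[OF assms(1)] finite_rays
      by (intro sum.mono_neutral_left) (auto simp: balanced_def)
    ultimately have "(\<Sum>u\<in>\<rho>. (a u - b u) *\<^sub>R v u) = 0"
      by simp
    moreover have "\<forall>c. (\<Sum>s\<in>\<rho>. c s *\<^sub>R v s) = 0 \<longrightarrow> (\<forall>s\<in>\<rho>. c s = 0)"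
      using cone_inj[OF assms(1)] cone_independent[OF assms(1)]
      by (subst inj_independent_iff[symmetric]) (simp_all add: finite_cone[OF assms(1)])
    ultimately have "a u - b u = 0"
      using True by (auto dest!: spec[of _ "\<lambda>u. a u - b u"])
    then show ?thesis by simp
  qed (use assms in \<open>simp add: balanced_def\<close>)
qed

text \<open>Weights of all degrees at once: balancing is demanded at every cone, so that
  \<open>act\<close>, which lowers degree by one, stays within a single type of object.\<close>

definition weight :: "('v set \<Rightarrow> real) \<Rightarrow> bool"
  where "weight w \<longleftrightarrow> (\<forall>\<sigma>. w \<sigma> \<noteq> 0 \<longrightarrow> \<sigma> \<in> K) \<and> (\<forall>\<rho>\<in>K. \<exists>a. balanced w \<rho> a)"

text \<open>The action of \<open>\<partial>\<^sub>s\<close> on Minkowski weights, that is, the intersection product with the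
  divisor of the piecewise linear function \<open>\<partial>\<^sub>s\<close>.\<close>

definition act :: "'v \<Rightarrow> ('v set \<Rightarrow> real) \<Rightarrow> 'v set \<Rightarrow> real"
  where "act s w \<rho> = (if \<rho> \<in> K then (THE a. balanced w \<rho> a) s else 0)"

lemma act_eqI:
  assumes "\<rho> \<in> K" "balanced w \<rho> a"
  shows "act s w \<rho> = a s"
proof -
  have "(THE a. balanced w \<rho> a) = a"
    using assms(2) balanced_unique[OF assms(1) _ assms(2)] by (rule the_equality)
  then show ?thesis
    using assms(1) by (simp add: act_def)
qed

lemma balanced_act:
  assumes "weight w" "\<rho> \<in> K"
  shows "balanced w \<rho> (\<lambda>s. act s w \<rho>)"
proof -
  obtain a where a: "balanced w \<rho> a"
    using assms by (auto simp: weight_def)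
  then have "(\<lambda>s. act s w \<rho>) = a"
    using act_eqI[OF assms(2) a] by auto
  with a show ?thesis by simp
qed

lemma act_sum: "weight w \<Longrightarrow> (\<Sum>s\<in>L. act s w \<rho> *\<^sub>R v s) = 0"
  using balanced_act[of w \<rho>] by (cases "\<rho> \<in> K") (auto simp: balanced_def act_def)

lemma act_zero: "act s (\<lambda>_. 0) = (\<lambda>_. 0)"
proof
  fix \<rho>
  show "act s (\<lambda>_. 0) \<rho> = 0"
    using act_eqI[of \<rho> "\<lambda>_. 0" "\<lambda>_. 0"] by (cases "\<rho> \<in> K") (auto simp: balanced_def act_def)
qed

end

section \<open>Commuting actions on weights and their integration to polynomials\<close>

locale simplicial_linear_complex = linear_complex L K v
  for L :: "'v set" and K :: "'v set set" and v :: "'v \<Rightarrow> real ^ 'n::finite" +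
  assumes cone_face: "\<sigma> \<in> K \<Longrightarrow> \<tau> \<subseteq> \<sigma> \<Longrightarrow> \<tau> \<in> K"
begin

lemma act_outside:
  assumes "weight w" "s \<notin> \<rho>"
  shows "act s w \<rho> = w (insert s \<rho>)"
proof (cases "\<rho> \<in> K")
  case True
  then show ?thesis
    using balanced_act[OF assms(1) True] assms(2) by (simp add: balanced_def)
next
  case False
  then have "insert s \<rho> \<notin> K"
    using cone_face by blast
  then show ?thesis
    using assms False by (auto simp: weight_def act_def)
qed

text \<open>Iterated over the elements of a set \<open>S\<close>, this confines the support of the
  resulting weight to cones whose union with \<open>S\<close> is a cone. For a nonface
  \<open>S\<close> nothing is left.\<close>

lemma act_support:
  assumes w: "weight w" and T: "\<And>\<sigma>. w \<sigma> \<noteq> 0 \<Longrightarrow> \<sigma> \<union> T \<in> K" and nz: "act s w \<rho> \<noteq> 0"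
  shows "\<rho> \<union> insert s T \<in> K"
proof (cases "s \<in> \<rho>")
  case False
  then show ?thesis
    using act_outside[OF w False] nz T[of "insert s \<rho>"] by simp
next
  case True
  have \<rho>: "\<rho> \<in> K"
    using nz by (auto simp: act_def split: if_splits)
  \<comment> \<open>If \<open>w\<close> vanished on every \<open>insert u \<rho>\<close> with
    \<open>u\<close> outside \<open>\<rho>\<close>, the zero relation would be the balanced one and
    \<open>act s w \<rho>\<close> would be 0.\<close>
  have "\<not> balanced w \<rho> (\<lambda>_. 0)"
    using act_eqI[OF \<rho>, of w "\<lambda>_. 0" s] nz by auto
  then obtain u where "w (insert u \<rho>) \<noteq> 0"
    by (auto simp: balanced_def)
  then have "insert u \<rho> \<union> T \<in> K"
    by (rule T)
  then show ?thesis
    by (rule cone_face) (use True in auto)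
qed

text \<open>The argument is Cartan's lemma: the vectors \<open>y t\<close> satisfy \<open>\<Sum>t. y t \<and> v t = 0\<close>, since the
  part of the coefficient matrix off \<open>\<rho>\<close> is symmetric; hence they are symmetric combinations of
  the \<open>v t\<close>.\<close>

lemma act_act_balanced:
  assumes w: "weight w" and \<rho>: "\<rho> \<in> K"
  shows "\<exists>B. (\<forall>s t. B s t = B t s) \<and> (\<forall>s. balanced (act s w) \<rho> (B s))"
proof -
  define A where "A u t = act t w (insert u \<rho>)" for u t
  \<comment> \<open>A relation for \<open>act t w\<close> at \<open>\<rho>\<close> exists exactly
    when generators of \<open>\<rho>\<close> can compensate \<open>y t\<close>.\<close>
  define y where "y t = (\<Sum>u\<in>L - \<rho>. A u t *\<^sub>R v u)" for t
  have split: "(\<Sum>t\<in>L. f t) = (\<Sum>t\<in>L - \<rho>. f t) + (\<Sum>t\<in>\<rho>. f t)" for f :: "'v \<Rightarrow> 'c::comm_monoid_add"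
    using sum.subset_diff[OF cone_subset[OF \<rho>] finite_rays] by blast
  have A_rel: "(\<Sum>t\<in>L. A u t *\<^sub>R v t) = 0" for u
    unfolding A_def by (rule act_sum[OF w])
  have A_sym: "A u t = A t u" if "u \<notin> \<rho>" "t \<notin> \<rho>" for u t
  proof (cases "u = t")
    case False
    then show ?thesis
      unfolding A_def using that by (simp add: act_outside[OF w] insert_commute)
  qed simp
  \<comment> \<open>The tensor with entries \<open>A u t\<close> on \<open>v u\<close> and
    \<open>v t\<close>, where \<open>u\<close> is off \<open>\<rho>\<close> and \<open>t\<close> in
    \<open>L\<close>, is zero by \<open>A_rel\<close>. It is contracted with \<open>l\<close> in
    either slot; by \<open>A_sym\<close> the contributions with both indices off
    \<open>\<rho>\<close> agree, hence so do the remaining ones.\<close>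
  have cartan: "(\<Sum>t\<in>\<rho>. l (v t) *\<^sub>R y t) = (\<Sum>t\<in>\<rho>. l (y t) *\<^sub>R v t)"
    if l: "linear l" for l :: "real ^ 'n \<Rightarrow> real"
  proof -
    have "0 = (\<Sum>u\<in>L - \<rho>. l (v u) *\<^sub>R (\<Sum>t\<in>L. A u t *\<^sub>R v t))"
      by (simp add: A_rel)
    also have "\<dots> = (\<Sum>u\<in>L - \<rho>. \<Sum>t\<in>L - \<rho>. (A u t * l (v u)) *\<^sub>R v t) +
        (\<Sum>u\<in>L - \<rho>. \<Sum>t\<in>\<rho>. (A u t * l (v u)) *\<^sub>R v t)"
      by (simp add: split scaleR_add_right scaleR_sum_right sum.distrib mult.commute)
    also have "(\<Sum>u\<in>L - \<rho>. \<Sum>t\<in>\<rho>. (A u t * l (v u)) *\<^sub>R v t) = (\<Sum>t\<in>\<rho>. l (y t) *\<^sub>R v t)"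
      by (subst sum.swap) (simp add: y_def linear_sum[OF l] linear_scale[OF l] scaleR_sum_left)
    finally have 1: "(\<Sum>u\<in>L - \<rho>. \<Sum>t\<in>L - \<rho>. (A u t * l (v u)) *\<^sub>R v t) = - (\<Sum>t\<in>\<rho>. l (y t) *\<^sub>R v t)"
      by (simp add: eq_neg_iff_add_eq_0)
    have "0 = (\<Sum>u\<in>L - \<rho>. l (\<Sum>t\<in>L. A u t *\<^sub>R v t) *\<^sub>R v u)"
      by (simp add: A_rel linear_0[OF l])
    also have "\<dots> = (\<Sum>u\<in>L - \<rho>. \<Sum>t\<in>L - \<rho>. (A u t * l (v t)) *\<^sub>R v u) +
        (\<Sum>u\<in>L - \<rho>. \<Sum>t\<in>\<rho>. (A u t * l (v t)) *\<^sub>R v u)"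
      by (simp add: linear_add[OF l] linear_sum[OF l] linear_scale[OF l] split scaleR_add_left
          scaleR_sum_left sum.distrib)
    also have "(\<Sum>u\<in>L - \<rho>. \<Sum>t\<in>\<rho>. (A u t * l (v t)) *\<^sub>R v u) = (\<Sum>t\<in>\<rho>. l (v t) *\<^sub>R y t)"
      by (subst sum.swap) (simp add: y_def scaleR_sum_right mult.commute)
    finally have 2: "(\<Sum>u\<in>L - \<rho>. \<Sum>t\<in>L - \<rho>. (A u t * l (v t)) *\<^sub>R v u) = - (\<Sum>t\<in>\<rho>. l (v t) *\<^sub>R y t)"
      by (simp add: eq_neg_iff_add_eq_0)
    have "(\<Sum>u\<in>L - \<rho>. \<Sum>t\<in>L - \<rho>. (A u t * l (v u)) *\<^sub>R v t) =
        (\<Sum>t\<in>L - \<rho>. \<Sum>u\<in>L - \<rho>. (A t u * l (v u)) *\<^sub>R v t)"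
      by (subst sum.swap) (auto intro!: sum.cong simp: A_sym)
    with 1 2 show ?thesis by simp
  qed
  have "\<forall>s. \<exists>l. linear l \<and> (\<forall>t\<in>\<rho>. l (v t) = (if t = s then 1 else 0 :: real))"
    using dual_functional[OF \<rho>] by blast
  then obtain l where lin: "linear (l s)" and dual: "t \<in> \<rho> \<Longrightarrow> l s (v t) = (if t = s then 1 else 0 :: real)"
    for s t by metis
  have y_eq: "y s = (\<Sum>t\<in>\<rho>. l s (y t) *\<^sub>R v t)" if "s \<in> \<rho>" for s
  proof -
    have "(\<Sum>t\<in>\<rho>. l s (v t) *\<^sub>R y t) = (\<Sum>t\<in>\<rho>. if t = s then y t else 0)"
      by (intro sum.cong) (auto simp: dual)
    also have "\<dots> = y s"
      using that finite_cone[OF \<rho>] by simp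
    finally show ?thesis
      using cartan[OF lin[of s]] by simp
  qed
  have l_sym: "l r (y s) = l s (y r)" if "s \<in> \<rho>" "r \<in> \<rho>" for r s
  proof -
    have "l r (y s) = (\<Sum>t\<in>\<rho>. l s (y t) * l r (v t))"
      by (subst y_eq[OF that(1)]) (simp add: linear_sum[OF lin] linear_scale[OF lin])
    also have "\<dots> = (\<Sum>t\<in>\<rho>. if t = r then l s (y t) else 0)"
      by (intro sum.cong) (auto simp: dual)
    also have "\<dots> = l s (y r)"
      using that finite_cone[OF \<rho>] by simp
    finally show ?thesis .
  qed
  \<comment> \<open>\<open>B s t\<close> is to be the value at \<open>\<rho>\<close> of both
    iterated actions. For \<open>t\<close> off \<open>\<rho>\<close> it is forced by balancing, for
    \<open>s\<close> off \<open>\<rho>\<close> by symmetry, and with both in \<open>\<rho>\<close>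
    it is the coefficient that compensates \<open>y s\<close>, symmetric by
    \<open>l_sym\<close>.\<close>
  define B where "B s t = (if t \<notin> \<rho> then A t s else if s \<notin> \<rho> then A s t else - l s (y t))" for s t
  have "B s t = B t s" for s t
    using A_sym l_sym by (auto simp: B_def)
  moreover have "balanced (act s w) \<rho> (B s)" for s
  proof -
    have "(\<Sum>t\<in>L. B s t *\<^sub>R v t) = 0"
    proof (cases "s \<in> \<rho>")
      case True
      have "(\<Sum>t\<in>L. B s t *\<^sub>R v t) = y s - (\<Sum>t\<in>\<rho>. l s (y t) *\<^sub>R v t)"
        using True by (simp add: split B_def y_def sum_negf)
      then show ?thesis
        using y_eq[OF True] by simp
    next
      case False
      have "(\<Sum>t\<in>L. B s t *\<^sub>R v t) = (\<Sum>t\<in>L. A s t *\<^sub>R v t)"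
        using False A_sym by (intro sum.cong) (auto simp: B_def)
      then show ?thesis
        by (simp add: A_rel)
    qed
    then show ?thesis
      by (auto simp: balanced_def B_def A_def)
  qed
  ultimately show ?thesis by blast
qed

lemma weight_act:
  assumes "weight w"
  shows "weight (act s w)"
proof -
  have "\<exists>a. balanced (act s w) \<rho> a" if "\<rho> \<in> K" for \<rho>
    using act_act_balanced[OF assms that] by meson
  then show ?thesis
    by (auto simp: weight_def act_def split: if_splits)
qed

lemma act_commute:
  assumes "weight w"
  shows "act s (act t w) = act t (act s w)"
proof
  fix \<rho>
  show "act s (act t w) \<rho> = act t (act s w) \<rho>"
  proof (cases "\<rho> \<in> K")
    case True
    then show ?thesis
      using act_act_balanced[OF assms True] by (metis act_eqI)
  qed (simp add: act_def)
qed

text \<open>Euler's identity \<open>(j + 1) V = (\<Sum>s. x\<^sub>s \<partial>\<^sub>s V)\<close>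
  for a form of degree \<open>j + 1\<close>, read as a recursion in which
  \<open>\<partial>\<^sub>s V\<close> is prescribed to be the polynomial of
  \<open>act s w\<close>.\<close>

primrec vol :: "nat \<Rightarrow> ('v set \<Rightarrow> real) \<Rightarrow> 'v mpoly" where
  "vol 0 w = mconst (w {})"
| "vol (Suc j) w = mconst (1 / real (Suc j)) * (\<Sum>s\<in>L. mvar s * vol j (act s w))"

lemma vol_forms: "vol j w \<in> forms L j"
proof (induction j arbitrary: w)
  case (Suc j)
  have "(\<Sum>s\<in>L. mvar s * vol j (act s w)) \<in> forms L (1 + j)"
    using Suc by (intro forms_sum forms_mult forms_mvar)
  then show ?case
    by (simp add: forms_mconst_mult)
qed (simp add: forms_mconst)

lemma vol_zero: "vol j (\<lambda>_. 0) = 0"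
  by (induction j) (simp_all add: act_zero)

text \<open>The integrability condition is \<open>act_commute\<close>. Differentiating the recursion
  gives one copy of \<open>vol (Suc j) (act t w)\<close> from the factor \<open>mvar t\<close> and
  \<open>j + 1\<close> copies from the induction hypothesis, which together cancel the denominator
  \<open>j + 2\<close>.\<close>

lemma partial_deriv_vol:
  assumes "weight w" "t \<in> L"
  shows "partial_deriv t (vol (Suc j) w) = vol j (act t w)"
  using assms
proof (induction j arbitrary: w)
  case 0
  have "(\<Sum>s\<in>L. partial_deriv t (mvar s * mconst (act s w {}))) =
      (\<Sum>s\<in>L. if s = t then mconst (act t w {}) else 0)"
    by (intro sum.cong) (auto simp: partial_deriv_mult partial_deriv_mvar)
  then show ?case
    using 0 finite_rays by (simp add: partial_deriv_sum)
next
  case (Suc j)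
  have "(\<Sum>s\<in>L. partial_deriv t (mvar s * vol (Suc j) (act s w))) =
      (\<Sum>s\<in>L. (if s = t then vol (Suc j) (act t w) else 0) + mvar s * vol j (act s (act t w)))"
    using Suc.prems weight_act[OF Suc.prems(1)] Suc.IH
    by (intro sum.cong refl, simp only: partial_deriv_mult)
      (auto simp: partial_deriv_mvar act_commute[OF Suc.prems(1)] simp del: vol.simps)
  also have "\<dots> = vol (Suc j) (act t w) + (\<Sum>s\<in>L. mvar s * vol j (act s (act t w)))"
    using Suc.prems finite_rays by (simp add: sum.distrib del: vol.simps)
  also have "(\<Sum>s\<in>L. mvar s * vol j (act s (act t w))) = mconst (real (Suc j)) * vol (Suc j) (act t w)"
    by (simp add: mult.assoc[symmetric] flip: mconst_mult del: of_nat_Suc)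
  also have "vol (Suc j) (act t w) + mconst (real (Suc j)) * vol (Suc j) (act t w) =
      mconst (real (Suc (Suc j))) * vol (Suc j) (act t w)"
    by (metis (no_types) distrib_right mconst_1 mconst_add mult_1 of_nat_Suc)
  finally show ?case
    unfolding vol.simps(2)[of "Suc j"]
    by (simp add: partial_deriv_mult partial_deriv_sum mult.assoc[symmetric] flip: mconst_mult
        del: of_nat_Suc vol.simps)
qed

text \<open>In degree 0 this is a coordinate of the relation \<open>act_sum\<close> at the empty
  cone. In higher degree, \<open>act_commute\<close> reduces it to the same statement for the
  weights \<open>act t w\<close>.\<close>

lemma sum_vol_act:
  assumes "weight w"
  shows "(\<Sum>s\<in>L. mconst (v s $ k) * vol j (act s w)) = 0"
  using assms
proof (induction j arbitrary: w)
  case 0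
  have "(\<Sum>s\<in>L. v s $ k * act s w {}) = (\<Sum>s\<in>L. act s w {} *\<^sub>R v s) $ k"
    by (simp add: mult.commute)
  also have "\<dots> = 0"
    by (simp add: act_sum[OF 0])
  finally show ?case
    by (simp flip: mconst_mult mconst_sum)
next
  case (Suc j)
  have "(\<Sum>s\<in>L. mconst (v s $ k) * vol (Suc j) (act s w)) =
      mconst (1 / real (Suc j)) * (\<Sum>s\<in>L. \<Sum>t\<in>L. mvar t * (mconst (v s $ k) * vol j (act s (act t w))))"
    by (simp add: sum_distrib_left act_commute[OF Suc.prems] mult_ac del: of_nat_Suc)
  also have "(\<Sum>s\<in>L. \<Sum>t\<in>L. mvar t * (mconst (v s $ k) * vol j (act s (act t w)))) =
      (\<Sum>t\<in>L. mvar t * (\<Sum>s\<in>L. mconst (v s $ k) * vol j (act s (act t w))))"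
    by (subst sum.swap) (simp add: sum_distrib_left)
  also have "\<dots> = 0"
    using Suc.IH[OF weight_act[OF Suc.prems]] by simp
  finally show ?case by simp
qed

text \<open>The witness is the iterated action of the elements of \<open>S\<close> on
  \<open>w\<close>. Its value at the empty cone yields the equations for top-dimensional cones, and
  its support condition those for nonfaces.\<close>

lemma prod_mvar_vol:
  assumes "finite S" "S \<subseteq> L" "weight w"
  shows "\<exists>w'. weight w' \<and> (\<forall>\<rho>. \<rho> \<inter> S = {} \<longrightarrow> w' \<rho> = w (\<rho> \<union> S)) \<and>
    (\<forall>\<rho>. w' \<rho> \<noteq> 0 \<longrightarrow> \<rho> \<union> S \<in> K) \<and>
    apply_diff (\<Prod>s\<in>S. mvar s) (vol (card S + i) w) = vol i w'"
  using assms
proof (induction S arbitrary: i)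
  case empty
  then show ?case
    by (intro exI[of _ w]) (auto simp: weight_def)
next
  case (insert s S)
  \<comment> \<open>The induction hypothesis is taken one degree higher, which leaves a degree for
    the derivative by \<open>s\<close>.\<close>
  obtain w' where w': "weight w'" "\<And>\<rho>. \<rho> \<inter> S = {} \<Longrightarrow> w' \<rho> = w (\<rho> \<union> S)"
    "\<And>\<rho>. w' \<rho> \<noteq> 0 \<Longrightarrow> \<rho> \<union> S \<in> K"
    "apply_diff (\<Prod>s\<in>S. mvar s) (vol (card S + Suc i) w) = vol (Suc i) w'"
    using insert.IH[of "Suc i"] insert.prems by blast
  show ?case
  proof (intro exI[of _ "act s w'"] conjI allI impI)
    show "weight (act s w')"
      by (rule weight_act[OF w'(1)])
    show "act s w' \<rho> = w (\<rho> \<union> insert s S)" if "\<rho> \<inter> insert s S = {}" for \<rho>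
      using that insert.hyps act_outside[OF w'(1), of s \<rho>] w'(2)[of "insert s \<rho>"] by auto
    show "\<rho> \<union> insert s S \<in> K" if "act s w' \<rho> \<noteq> 0" for \<rho>
      using act_support[OF w'(1) w'(3) that] .
    show "apply_diff (\<Prod>s\<in>insert s S. mvar s) (vol (card (insert s S) + i) w) = vol i (act s w')"
      using insert.hyps insert.prems w'(4) partial_deriv_vol[OF w'(1), of s i]
      by (simp add: apply_diff_mult apply_diff_mvar del: vol.simps)
  qed
qed

end

text \<open>The differential equations that characterise \<open>mixed_volume\<close>; see \<open>mixed_volume_unique\<close>.\<close>

definition is_volume :: "nat \<Rightarrow> ('v, 'n::finite) fan \<Rightarrow> ('v set \<Rightarrow> real) \<Rightarrow> 'v mpoly \<Rightarrow> bool"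
  where "is_volume d \<Delta> w V \<longleftrightarrow> V \<in> forms (rays \<Delta>) d \<and>
    (\<forall>S. S \<subseteq> rays \<Delta> \<longrightarrow> S \<notin> cones \<Delta> \<longrightarrow> apply_diff (\<Prod>s\<in>S. mvar s) V = 0) \<and>
    (\<forall>k. apply_diff (theta \<Delta> k) V = 0) \<and>
    (\<forall>\<sigma>\<in>cones \<Delta>. card \<sigma> = d \<longrightarrow> apply_diff (\<Prod>s\<in>\<sigma>. mvar s) V = mconst (w \<sigma>))"

lemma is_volumeD:
  assumes "is_volume d \<Delta> w V"
  shows "V \<in> forms (rays \<Delta>) d"
    and "S \<subseteq> rays \<Delta> \<Longrightarrow> S \<notin> cones \<Delta> \<Longrightarrow> apply_diff (\<Prod>s\<in>S. mvar s) V = 0"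
    and "apply_diff (theta \<Delta> k) V = 0"
    and "\<sigma> \<in> cones \<Delta> \<Longrightarrow> card \<sigma> = d \<Longrightarrow> apply_diff (\<Prod>s\<in>\<sigma>. mvar s) V = mconst (w \<sigma>)"
  using assms by (auto simp: is_volume_def)

lemma simplicial_fan_complex:
  "simplicial_fan d \<Delta> \<Longrightarrow> simplicial_linear_complex (rays \<Delta>) (cones \<Delta>) (gen \<Delta>)"
  unfolding simplicial_fan_def by unfold_locales metis+

lemma volume_exists:
  assumes fan: "simplicial_fan d \<Delta>" and w: "w \<in> minkowski_weights \<Delta> d"
  shows "\<exists>V. is_volume d \<Delta> w V"
proof -
  interpret simplicial_linear_complex "rays \<Delta>" "cones \<Delta>" "gen \<Delta>"
    by (rule simplicial_fan_complex[OF fan])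
  \<comment> \<open>A Minkowski weight of degree \<open>d\<close> becomes a weight in all degrees by
    extension with 0.\<close>
  define w0 where "w0 \<sigma> = (if \<sigma> \<in> cones \<Delta> \<and> card \<sigma> = d then w \<sigma> else 0)" for \<sigma>
  have "\<exists>a. balanced w0 \<rho> a" if \<rho>: "\<rho> \<in> cones \<Delta>" for \<rho>
  proof (cases "card \<rho> + 1 = d")
    case False
    \<comment> \<open>All sets \<open>insert u \<rho>\<close> with \<open>u\<close> off
      \<open>\<rho>\<close> have the wrong size, so the prescribed values are 0.\<close>
    then have "balanced w0 \<rho> (\<lambda>_. 0)"
      using finite_cone[OF \<rho>] by (auto simp: balanced_def w0_def)
    then show ?thesis by blast
  next
    case True
    let ?x = "\<Sum>s | s \<in> rays \<Delta> - \<rho> \<and> insert s \<rho> \<in> cones \<Delta>. w (insert s \<rho>) *\<^sub>R gen \<Delta> s"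
    have "?x \<in> span (gen \<Delta> ` \<rho>)"
      using w \<rho> True by (simp add: minkowski_weights_def)
    then obtain c where "?x = (\<Sum>y\<in>gen \<Delta> ` \<rho>. c y *\<^sub>R y)"
      using span_finite[of "gen \<Delta> ` \<rho>"] finite_cone[OF \<rho>] by auto
    then have c: "?x = (\<Sum>s\<in>\<rho>. c (gen \<Delta> s) *\<^sub>R gen \<Delta> s)"
      by (simp add: sum.reindex[OF cone_inj[OF \<rho>]])
    have "?x = (\<Sum>s\<in>rays \<Delta> - \<rho>. w0 (insert s \<rho>) *\<^sub>R gen \<Delta> s)"
      using finite_rays True finite_cone[OF \<rho>]
      by (intro sum.mono_neutral_cong_left) (auto simp: w0_def)
    \<comment> \<open>Membership in the span is turned into a relation: the coefficients of the
      combination enter on \<open>\<rho>\<close> with the opposite sign.\<close>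
    with c have "(\<Sum>s\<in>rays \<Delta>. (if s \<in> \<rho> then - c (gen \<Delta> s) else w0 (insert s \<rho>)) *\<^sub>R gen \<Delta> s) = 0"
      by (simp add: sum.subset_diff[OF cone_subset[OF \<rho>] finite_rays] sum_negf)
    then show ?thesis
      by (intro exI[of _ "\<lambda>s. if s \<in> \<rho> then - c (gen \<Delta> s) else w0 (insert s \<rho>)"])
        (auto simp: balanced_def)
  qed
  then have wt: "weight w0"
    by (auto simp: weight_def w0_def)
  have forms: "vol d w0 \<in> forms (rays \<Delta>) d"
    by (rule vol_forms)
  have "apply_diff (\<Prod>s\<in>S. mvar s) (vol d w0) = 0" if S: "S \<subseteq> rays \<Delta>" "S \<notin> cones \<Delta>" for S
  proof (cases "card S \<le> d")
    case True
    then obtain w' where w': "\<And>\<rho>. w' \<rho> \<noteq> 0 \<Longrightarrow> \<rho> \<union> S \<in> cones \<Delta>"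
      "apply_diff (\<Prod>s\<in>S. mvar s) (vol d w0) = vol (d - card S) w'"
      using prod_mvar_vol[OF finite_subset[OF S(1) finite_rays] S(1) wt, of "d - card S"] by auto
    have "w' = (\<lambda>_. 0)"
      using w'(1) cone_face S(2) by (metis sup_ge2)
    then show ?thesis
      by (simp add: w'(2) vol_zero)
  next
    case False
    then show ?thesis
      using forms_prod_mvar[OF S(1)] by (intro apply_diff_high[OF _ forms]) (auto simp: forms_iff in_keys_iff)
  qed
  moreover have "apply_diff (theta \<Delta> k) (vol d w0) = 0" for k
  proof (cases d)
    case (Suc j)
    show ?thesis
      using sum_vol_act[OF wt, of k j]
      by (simp add: Suc theta_def apply_diff_sum_left apply_diff_mult apply_diff_mconst apply_diff_mvar
          partial_deriv_vol[OF wt] del: vol.simps)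
  qed (simp add: theta_def apply_diff_sum_left apply_diff_mult apply_diff_mconst apply_diff_mvar)
  moreover have "apply_diff (\<Prod>s\<in>\<sigma>. mvar s) (vol d w0) = mconst (w \<sigma>)"
    if \<sigma>: "\<sigma> \<in> cones \<Delta>" "card \<sigma> = d" for \<sigma>
    using prod_mvar_vol[OF finite_cone[OF \<sigma>(1)] cone_subset[OF \<sigma>(1)] wt, of 0] \<sigma>
    by (auto simp: w0_def)
  ultimately show ?thesis
    using forms unfolding is_volume_def by blast
qed

subsection \<open>Uniqueness of the mixed volume\<close>

lemma poly_carrier_iff: "f \<in> carrier (poly_ring L) \<longleftrightarrow> (\<forall>m. lookup f m \<noteq> 0 \<longrightarrow> keys m \<subseteq> L)"
  unfolding poly_ring_def indets_def in_keys_iff[symmetric] by auto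

lemma forms_carrier: "f \<in> forms L j \<Longrightarrow> f \<in> carrier (poly_ring L)"
  by (simp add: forms_def)

lemma poly_ring_simps [simp]:
  "\<zero>\<^bsub>poly_ring L\<^esub> = 0" "\<one>\<^bsub>poly_ring L\<^esub> = 1"
  "f \<oplus>\<^bsub>poly_ring L\<^esub> g = f + g" "f \<otimes>\<^bsub>poly_ring L\<^esub> g = f * g"
  by (simp_all add: poly_ring_def)

lemma carrier_0 [simp]: "0 \<in> carrier (poly_ring L)"
  by (simp add: poly_carrier_iff)

lemma carrier_1 [simp]: "1 \<in> carrier (poly_ring L)"
  using forms_carrier[OF forms_mconst[of 1]] by simp

lemma carrier_add:
  "f \<in> carrier (poly_ring L) \<Longrightarrow> g \<in> carrier (poly_ring L) \<Longrightarrow> f + g \<in> carrier (poly_ring L)"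
  unfolding poly_carrier_iff lookup_add by (metis add.right_neutral)

lemma carrier_uminus: "f \<in> carrier (poly_ring L) \<Longrightarrow> - f \<in> carrier (poly_ring L)"
  by (simp add: poly_carrier_iff)

lemma carrier_mult:
  assumes "f \<in> carrier (poly_ring L)" "g \<in> carrier (poly_ring L)"
  shows "f * g \<in> carrier (poly_ring L)"
  unfolding poly_carrier_iff
proof (intro allI impI)
  fix m
  assume "lookup (f * g) m \<noteq> 0"
  then have m: "m \<in> keys (f * g)"
    by (simp add: in_keys_iff)
  obtain a b where "m = a + b" "a \<in> keys f" "b \<in> keys g"
    using subsetD[OF keys_mult m] by blast
  then show "keys m \<subseteq> L"
    using assms by (simp add: poly_carrier_iff keys_add_nat in_keys_iff)
qed

lemma cring_poly_ring: "cring (poly_ring L)"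
proof (rule cringI)
  show "abelian_group (poly_ring L)"
  proof (rule abelian_groupI)
    fix f
    assume "f \<in> carrier (poly_ring L)"
    then show "\<exists>g\<in>carrier (poly_ring L). g \<oplus>\<^bsub>poly_ring L\<^esub> f = \<zero>\<^bsub>poly_ring L\<^esub>"
      by (intro bexI[of _ "- f"]) (simp_all add: carrier_uminus)
  qed (auto simp: carrier_add add_ac)
  show "Group.comm_monoid (poly_ring L)"
    by unfold_locales (auto simp: carrier_mult mult_ac)
qed (simp add: algebra_simps)

lemma poly_ring_minus:
  assumes "f \<in> carrier (poly_ring L)" "g \<in> carrier (poly_ring L)"
  shows "f \<ominus>\<^bsub>poly_ring L\<^esub> g = f - g"
proof -
  interpret cring "poly_ring L" by (rule cring_poly_ring)
  have "\<ominus>\<^bsub>poly_ring L\<^esub> g = - g"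
    by (rule minus_equality) (use assms in \<open>simp_all add: carrier_uminus\<close>)
  then show ?thesis
    by (simp add: a_minus_def)
qed

text \<open>Thus an equation checked on generators of an ideal extends to the whole ideal by
  minimality of \<open>genideal\<close>.\<close>

lemma annihilator_ideal:
  "ideal {f \<in> carrier (poly_ring L). apply_diff f V = 0} (poly_ring L)"
proof -
  interpret cring "poly_ring L" by (rule cring_poly_ring)
  have inv: "\<ominus>\<^bsub>poly_ring L\<^esub> f = - f" if "f \<in> carrier (poly_ring L)" for f
    by (rule minus_equality) (use that in \<open>simp_all add: carrier_uminus\<close>)
  show ?thesis
  proof (rule idealI)
    show "subgroup {f \<in> carrier (poly_ring L). apply_diff f V = 0} (add_monoid (poly_ring L))"
    proof (rule subgroup.intro)
      fix f
      assume "f \<in> {f \<in> carrier (poly_ring L). apply_diff f V = 0}"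
      then show "inv\<^bsub>add_monoid (poly_ring L)\<^esub> f \<in> {f \<in> carrier (poly_ring L). apply_diff f V = 0}"
        using inv[of f] by (simp add: a_inv_def carrier_uminus apply_diff_uminus_left)
    qed (auto simp: carrier_add apply_diff_add_left)
  next
    fix f g
    assume "f \<in> {f \<in> carrier (poly_ring L). apply_diff f V = 0}" "g \<in> carrier (poly_ring L)"
    then show "g \<otimes>\<^bsub>poly_ring L\<^esub> f \<in> {f \<in> carrier (poly_ring L). apply_diff f V = 0}"
      and "f \<otimes>\<^bsub>poly_ring L\<^esub> g \<in> {f \<in> carrier (poly_ring L). apply_diff f V = 0}"
      by (simp_all add: carrier_mult apply_diff_mult[of g f] apply_diff_mult'[of f g])
  qed (rule ring_axioms)
qed

lemma prod_mvar_carrier: "S \<subseteq> L \<Longrightarrow> (\<Prod>s\<in>S. mvar s) \<in> carrier (poly_ring L)"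
  by (rule forms_carrier) (rule forms_prod_mvar)

lemma theta_forms: "theta \<Delta> k \<in> forms (rays \<Delta>) 1"
  unfolding theta_def by (intro forms_sum forms_mconst_mult forms_mvar)

lemma ideal_sr: "ideal (sr_ideal \<Delta>) (poly_ring (rays \<Delta>))"
  and sr_ideal_gen: "S \<subseteq> rays \<Delta> \<Longrightarrow> S \<notin> cones \<Delta> \<Longrightarrow> (\<Prod>s\<in>S. mvar s) \<in> sr_ideal \<Delta>"
  and sr_ideal_minimal: "ideal I (poly_ring (rays \<Delta>)) \<Longrightarrow>
    (\<And>S. S \<subseteq> rays \<Delta> \<Longrightarrow> S \<notin> cones \<Delta> \<Longrightarrow> (\<Prod>s\<in>S. mvar s) \<in> I) \<Longrightarrow> sr_ideal \<Delta> \<subseteq> I"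
proof -
  interpret cring "poly_ring (rays \<Delta>)" by (rule cring_poly_ring)
  let ?G = "{\<Prod>s\<in>S. mvar s | S. S \<subseteq> rays \<Delta> \<and> S \<notin> cones \<Delta>}"
  have G: "?G \<subseteq> carrier (poly_ring (rays \<Delta>))"
    using prod_mvar_carrier by blast
  show "ideal (sr_ideal \<Delta>) (poly_ring (rays \<Delta>))"
    unfolding sr_ideal_def by (rule genideal_ideal[OF G])
  show "S \<subseteq> rays \<Delta> \<Longrightarrow> S \<notin> cones \<Delta> \<Longrightarrow> (\<Prod>s\<in>S. mvar s) \<in> sr_ideal \<Delta>"
    using genideal_self[OF G] unfolding sr_ideal_def by blast
  show "sr_ideal \<Delta> \<subseteq> I" if "ideal I (poly_ring (rays \<Delta>))"
    "\<And>S. S \<subseteq> rays \<Delta> \<Longrightarrow> S \<notin> cones \<Delta> \<Longrightarrow> (\<Prod>s\<in>S. mvar s) \<in> I"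
    unfolding sr_ideal_def by (rule genideal_minimal) (use that in blast)+
qed

lemma cring_sr: "cring (sr_ring \<Delta>)"
  unfolding sr_ring_def by (rule ideal.quotient_is_cring[OF ideal_sr cring_poly_ring])

lemma sr_class_hom: "sr_class \<Delta> \<in> ring_hom (poly_ring (rays \<Delta>)) (sr_ring \<Delta>)"
  unfolding sr_ring_def sr_class_def[abs_def] by (rule ideal.rcos_ring_hom[OF ideal_sr])

lemma theta_class_carrier: "range (\<lambda>k. sr_class \<Delta> (theta \<Delta> k)) \<subseteq> carrier (sr_ring \<Delta>)"
  using ring_hom_closed[OF sr_class_hom] forms_carrier[OF theta_forms] by blast

lemma ideal_theta: "ideal (theta_ideal \<Delta>) (sr_ring \<Delta>)"
proof -
  interpret cring "sr_ring \<Delta>" by (rule cring_sr)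
  show ?thesis
    unfolding theta_ideal_def by (rule genideal_ideal[OF theta_class_carrier])
qed

lemma chow_class_hom: "chow_class \<Delta> \<in> ring_hom (poly_ring (rays \<Delta>)) (chow_ring \<Delta>)"
proof -
  have "(+>\<^bsub>sr_ring \<Delta>\<^esub>) (theta_ideal \<Delta>) \<circ> sr_class \<Delta> \<in> ring_hom (poly_ring (rays \<Delta>)) (chow_ring \<Delta>)"
    unfolding chow_ring_def
    by (rule ring_hom_trans[OF sr_class_hom ideal.rcos_ring_hom[OF ideal_theta]])
  then show ?thesis
    by (simp add: comp_def chow_class_def[abs_def])
qed

lemma cring_chow: "cring (chow_ring \<Delta>)"
  unfolding chow_ring_def by (rule ideal.quotient_is_cring[OF ideal_theta cring_sr])

lemma chow_class_zero: "chow_class \<Delta> 0 = \<zero>\<^bsub>chow_ring \<Delta>\<^esub>"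
proof -
  interpret ring_hom_cring "poly_ring (rays \<Delta>)" "chow_ring \<Delta>" "chow_class \<Delta>"
    by (intro ring_hom_cring.intro ring_hom_cring_axioms.intro cring_poly_ring cring_chow chow_class_hom)
  show ?thesis
    using hom_zero by simp
qed

lemma chow_class_add: "f \<in> carrier (poly_ring (rays \<Delta>)) \<Longrightarrow> g \<in> carrier (poly_ring (rays \<Delta>)) \<Longrightarrow>
    chow_class \<Delta> (f + g) = chow_class \<Delta> f \<oplus>\<^bsub>chow_ring \<Delta>\<^esub> chow_class \<Delta> g"
  using ring_hom_add[OF chow_class_hom] by fastforce

lemma chow_class_mult: "f \<in> carrier (poly_ring (rays \<Delta>)) \<Longrightarrow> g \<in> carrier (poly_ring (rays \<Delta>)) \<Longrightarrow>
    chow_class \<Delta> (f * g) = chow_class \<Delta> f \<otimes>\<^bsub>chow_ring \<Delta>\<^esub> chow_class \<Delta> g"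
  using ring_hom_mult[OF chow_class_hom] by fastforce

lemma chow_class_mult_zero:
  assumes "f \<in> carrier (poly_ring (rays \<Delta>))" "g \<in> carrier (poly_ring (rays \<Delta>))"
    and "chow_class \<Delta> g = chow_class \<Delta> 0"
  shows "chow_class \<Delta> (f * g) = chow_class \<Delta> 0"
proof -
  interpret cring "chow_ring \<Delta>" by (rule cring_chow)
  show ?thesis
    using assms ring_hom_closed[OF chow_class_hom assms(1)]
    by (simp add: chow_class_mult chow_class_zero)
qed

lemma sr_class_zero: "sr_class \<Delta> 0 = \<zero>\<^bsub>sr_ring \<Delta>\<^esub>"
proof -
  interpret ring_hom_cring "poly_ring (rays \<Delta>)" "sr_ring \<Delta>" "sr_class \<Delta>"
    by (intro ring_hom_cring.intro ring_hom_cring_axioms.intro cring_poly_ring cring_sr sr_class_hom)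
  show ?thesis
    using hom_zero by simp
qed

lemma chow_class_nonface:
  assumes "S \<subseteq> rays \<Delta>" "S \<notin> cones \<Delta>"
  shows "chow_class \<Delta> (\<Prod>s\<in>S. mvar s) = chow_class \<Delta> 0"
proof -
  interpret cring "poly_ring (rays \<Delta>)" by (rule cring_poly_ring)
  have "(\<Prod>s\<in>S. mvar s) \<ominus>\<^bsub>poly_ring (rays \<Delta>)\<^esub> 0 \<in> sr_ideal \<Delta>"
    using sr_ideal_gen[OF assms] by (simp add: poly_ring_minus prod_mvar_carrier[OF assms(1)])
  then have "sr_class \<Delta> (\<Prod>s\<in>S. mvar s) = sr_class \<Delta> 0"
    unfolding sr_class_def
    by (subst quotient_eq_iff_same_a_r_cos[OF ideal_sr, symmetric])
      (simp_all add: prod_mvar_carrier[OF assms(1)])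
  then show ?thesis
    by (simp add: chow_class_def)
qed

lemma chow_class_theta: "chow_class \<Delta> (theta \<Delta> k) = chow_class \<Delta> 0"
proof -
  interpret cring "sr_ring \<Delta>" by (rule cring_sr)
  have carr: "sr_class \<Delta> (theta \<Delta> k) \<in> carrier (sr_ring \<Delta>)"
    using theta_class_carrier by blast
  have "sr_class \<Delta> (theta \<Delta> k) \<in> theta_ideal \<Delta>"
    using genideal_self[OF theta_class_carrier] by (auto simp: theta_ideal_def)
  then have "sr_class \<Delta> (theta \<Delta> k) \<ominus>\<^bsub>sr_ring \<Delta>\<^esub> sr_class \<Delta> 0 \<in> theta_ideal \<Delta>"
    using carr by (simp add: sr_class_zero a_minus_def)
  then show ?thesis
    unfolding chow_class_def
    by (subst quotient_eq_iff_same_a_r_cos[OF ideal_theta, symmetric]) (simp_all add: carr sr_class_zero)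
qed

text \<open>The annihilator of \<open>V\<close> contains the Stanley-Reisner ideal, and its image in
  \<open>sr_ring\<close> is an ideal containing the classes of the linear parameters. Hence
  \<open>f - g\<close> agrees, up to the Stanley-Reisner ideal, with an element \<open>j\<close> of
  the annihilator and itself annihilates \<open>V\<close>.\<close>

lemma apply_diff_eq_if_chow_class_eq:
  assumes f: "f \<in> carrier (poly_ring (rays \<Delta>))" and g: "g \<in> carrier (poly_ring (rays \<Delta>))"
    and eq: "chow_class \<Delta> f = chow_class \<Delta> g"
    and sr: "\<And>S. S \<subseteq> rays \<Delta> \<Longrightarrow> S \<notin> cones \<Delta> \<Longrightarrow> apply_diff (\<Prod>s\<in>S. mvar s) V = 0"
    and lin: "\<And>k. apply_diff (theta \<Delta> k) V = 0"
  shows "apply_diff f V = apply_diff g V"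
proof -
  let ?R = "poly_ring (rays \<Delta>)"
  interpret R: cring ?R by (rule cring_poly_ring)
  interpret S: cring "sr_ring \<Delta>" by (rule cring_sr)
  interpret h: ring_hom_cring ?R "sr_ring \<Delta>" "sr_class \<Delta>"
    by (intro ring_hom_cring.intro ring_hom_cring_axioms.intro cring_poly_ring cring_sr sr_class_hom)
  let ?J = "{f \<in> carrier ?R. apply_diff f V = 0}"
  have sub: "sr_ideal \<Delta> \<subseteq> ?J"
    by (rule sr_ideal_minimal[OF annihilator_ideal]) (simp add: sr prod_mvar_carrier)
  have "ideal (sr_class \<Delta> ` ?J) (sr_ring \<Delta>)"
    unfolding sr_class_def[abs_def] sr_ring_def
    by (rule R.ring_ideal_imp_quot_ideal[OF ideal_sr annihilator_ideal])
  then have "theta_ideal \<Delta> \<subseteq> sr_class \<Delta> ` ?J"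
    unfolding theta_ideal_def
    by (rule S.genideal_minimal) (use forms_carrier[OF theta_forms] lin in blast)
  moreover have "sr_class \<Delta> f \<ominus>\<^bsub>sr_ring \<Delta>\<^esub> sr_class \<Delta> g \<in> theta_ideal \<Delta>"
    using eq f g unfolding chow_class_def by (simp add: S.quotient_eq_iff_same_a_r_cos[OF ideal_theta])
  ultimately obtain j where j: "j \<in> ?J" "sr_class \<Delta> f \<ominus>\<^bsub>sr_ring \<Delta>\<^esub> sr_class \<Delta> g = sr_class \<Delta> j"
    by blast
  have fg: "f - g \<in> carrier ?R"
    using R.minus_closed[OF f g] by (simp add: poly_ring_minus[OF f g])
  have "sr_class \<Delta> (f - g) = sr_class \<Delta> j"
    using j(2) f g
    by (simp add: a_minus_def h.hom_add h.hom_a_inv del: poly_ring_simps flip: poly_ring_minus[OF f g])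
  then have "(f - g) \<ominus>\<^bsub>?R\<^esub> j \<in> sr_ideal \<Delta>"
    using fg j(1) unfolding sr_class_def by (simp add: R.quotient_eq_iff_same_a_r_cos[OF ideal_sr])
  then have "apply_diff (f - g - j) V = 0"
    using sub fg j(1) by (auto simp: poly_ring_minus)
  then show ?thesis
    using j(1) by (simp add: apply_diff_diff_left)
qed

section \<open>Reduction to square-free monomials\<close>

lemma prod_mvar_eq_single: "(\<Prod>s\<in>S. mvar s) = single (\<Sum>s\<in>S. single s 1) 1"
  by (induction S rule: infinite_finite_induct) (simp_all add: mvar_def mult_single del: One_nat_def)

lemma lookup_sum_single:
  "finite S \<Longrightarrow> lookup (\<Sum>s\<in>S. single s (1::nat)) t = (if t \<in> S then 1 else 0)"
  by (induction S rule: finite_induct) (auto simp: lookup_add lookup_single when_def)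

lemma linear_vec_eq_sum:
  fixes l :: "real ^ 'n::finite \<Rightarrow> real"
  assumes "linear l"
  shows "l x = (\<Sum>k\<in>UNIV. x $ k * l (axis k 1))"
proof -
  have "l x = l (\<Sum>k\<in>UNIV. x $ k *\<^sub>R axis k 1)"
    using basis_expansion[of x] by (simp add: scalar_mult_eq_scaleR)
  then show ?thesis
    by (simp add: linear_sum[OF assms] linear_scale[OF assms])
qed

text \<open>The moving lemma: a repeated factor \<open>\<partial>\<^sub>s\<close> of a monomial supported on a cone \<open>\<sigma>\<close> is replaced
  by a linear combination of \<open>\<partial>\<^sub>t\<close> with \<open>t\<close> outside \<open>\<sigma>\<close>, so that the support grows.\<close>

lemma form_functional_eq_0:
  fixes \<Delta> :: "('v, 'n::finite) fan" and \<psi> :: "'v mpoly \<Rightarrow> real"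
  assumes complex: "linear_complex (rays \<Delta>) (cones \<Delta>) (gen \<Delta>)"
    and add: "\<And>f g. f \<in> forms (rays \<Delta>) d \<Longrightarrow> g \<in> forms (rays \<Delta>) d \<Longrightarrow> \<psi> (f + g) = \<psi> f + \<psi> g"
    and scale: "\<And>c f. f \<in> forms (rays \<Delta>) d \<Longrightarrow> \<psi> (mconst c * f) = c * \<psi> f"
    and sr: "\<And>S f. S \<subseteq> rays \<Delta> \<Longrightarrow> S \<notin> cones \<Delta> \<Longrightarrow> f \<in> carrier (poly_ring (rays \<Delta>)) \<Longrightarrow>
      f * (\<Prod>s\<in>S. mvar s) \<in> forms (rays \<Delta>) d \<Longrightarrow> \<psi> (f * (\<Prod>s\<in>S. mvar s)) = 0"
    and lin: "\<And>k f. f \<in> carrier (poly_ring (rays \<Delta>)) \<Longrightarrow> f * theta \<Delta> k \<in> forms (rays \<Delta>) d \<Longrightarrow>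
      \<psi> (f * theta \<Delta> k) = 0"
    and cone: "\<And>\<sigma>. \<sigma> \<in> cones \<Delta> \<Longrightarrow> card \<sigma> = d \<Longrightarrow> \<psi> (\<Prod>s\<in>\<sigma>. mvar s) = 0"
    and f: "f \<in> forms (rays \<Delta>) d"
  shows "\<psi> f = 0"
proof -
  interpret linear_complex "rays \<Delta>" "cones \<Delta>" "gen \<Delta>" by fact
  let ?L = "rays \<Delta>"
  have zero: "\<psi> 0 = 0"
    using scale[of 0 0] by simp
  have sum: "\<psi> (\<Sum>i\<in>I. h i) = (\<Sum>i\<in>I. \<psi> (h i))" if "\<And>i. i \<in> I \<Longrightarrow> h i \<in> forms ?L d"
    for I and h :: "'z \<Rightarrow> 'v mpoly"
    using that by (induction I rule: infinite_finite_induct) (simp_all add: zero add forms_sum)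
  have mono: "\<psi> (single m 1) = 0" if "keys m \<subseteq> ?L" "mdeg m = d" for m
    using that
  \<comment> \<open>Larger support comes first: the measure drops whenever a repeated variable is
    traded for a new one.\<close>
  proof (induction "d - card (keys m)" arbitrary: m rule: less_induct)
    case less
    let ?\<sigma> = "keys m" and ?e = "\<Sum>s\<in>keys m. single s (1::nat)"
    have e: "m = m - ?e + ?e"
      by (rule poly_mapping_eqI) (auto simp: lookup_add lookup_minus lookup_sum_single in_keys_iff
        simp del: One_nat_def)
    have prod: "single m 1 = single (m - ?e) 1 * (\<Prod>s\<in>?\<sigma>. mvar s)"
      unfolding prod_mvar_eq_single mult_single using e by simp
    have form: "single m 1 \<in> forms ?L d"
      using less.prems by (rule forms_single)
    consider "?\<sigma> \<notin> cones \<Delta>" | "?\<sigma> \<in> cones \<Delta>" "m = ?e"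
      | s where "?\<sigma> \<in> cones \<Delta>" "lookup m s \<ge> 2"
    proof (cases "\<exists>s. lookup m s \<ge> 2")
      case False
      then have "lookup m t = (if t \<in> ?\<sigma> then 1 else 0)" for t
        by (simp add: in_keys_iff) (metis One_nat_def Suc_1 Suc_leI less_Suc0 linorder_neqE_nat not_less_eq)
      then have "m = ?e"
        by (intro poly_mapping_eqI) (simp only: lookup_sum_single finite_keys)
      then show ?thesis using that by blast
    qed (use that in blast)
    then show ?case
    proof cases
      case 1
      have "keys (m - ?e) \<subseteq> ?L"
        using less.prems(1) by (auto simp: in_keys_iff lookup_minus)
      then have "single (m - ?e) (1::real) \<in> carrier (poly_ring ?L)"
        by (auto simp: poly_carrier_iff lookup_single when_def)
      then show ?thesis
        using sr[OF less.prems(1) 1, of "single (m - ?e) 1", folded prod] form by blast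
    next
      case 2
      have "card ?\<sigma> = d"
        using less.prems(2) 2(2) by (simp add: mdeg_def) (metis (no_types, lifting) One_nat_def
            card_eq_sum finite_keys lookup_sum_single sum.cong)
      then show ?thesis
        using cone[OF 2(1)] 2(2) by (simp add: prod_mvar_eq_single)
    next
      case 3
      define m' where "m' = m - single s 1"
      have m: "m = m' + single s 1"
        unfolding m'_def using 3(2)
        by (intro poly_mapping_eqI) (auto simp: lookup_add lookup_minus lookup_single when_def)
      have s: "s \<in> ?\<sigma>" and keys': "keys m' = ?\<sigma>"
        unfolding m'_def using 3(2) by (auto simp: in_keys_iff lookup_minus lookup_single when_def)
      have d: "d = mdeg m' + 1"
        using less.prems(2) m by simp
      obtain l where l: "linear l" "\<And>t. t \<in> ?\<sigma> \<Longrightarrow> l (gen \<Delta> t) = (if t = s then 1 else 0 :: real)"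
        using dual_functional[OF 3(1)] by blast
      have form_t: "single (m' + single t 1) c \<in> forms ?L d" if "t \<in> ?L" for t c
        using less.prems(1) that by (intro forms_single) (auto simp: keys_add_nat keys' d)
      have \<psi>_single: "\<psi> (single (m' + single t 1) c) = c * \<psi> (single (m' + single t 1) 1)" if "t \<in> ?L" for t c
        using scale[OF form_t[OF that, of 1], of c] by (simp add: mconst_def mult_single)
      have "(\<Sum>t\<in>?L. gen \<Delta> t $ k * \<psi> (single (m' + single t 1) 1)) = 0" for k
      proof -
        have expand: "single m' 1 * theta \<Delta> k = (\<Sum>t\<in>?L. single (m' + single t 1) (gen \<Delta> t $ k))"
          by (simp add: theta_def sum_distrib_left mconst_def mvar_def mult_single del: One_nat_def)
        have "\<psi> (single m' 1 * theta \<Delta> k) = 0"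
        proof (rule lin)
          show "single m' 1 * theta \<Delta> k \<in> forms ?L d"
            unfolding expand by (intro forms_sum form_t)
          show "single m' 1 \<in> carrier (poly_ring ?L)"
            using less.prems(1) by (auto simp: poly_carrier_iff lookup_single when_def keys')
        qed
        then show ?thesis
          unfolding expand
          by (subst (asm) sum) (simp_all add: form_t \<psi>_single[of _ "gen \<Delta> _ $ _"] del: One_nat_def)
      qed
      \<comment> \<open>Combining the coordinate relations with the weights
        \<open>l (axis k 1)\<close> gives the relation with coefficients
        \<open>l (gen \<Delta> t)\<close>, which on the support is the indicator of
        \<open>s\<close>.\<close>
      then have "(\<Sum>k\<in>UNIV. l (axis k 1) * (\<Sum>t\<in>?L. gen \<Delta> t $ k * \<psi> (single (m' + single t 1) 1))) = 0"
        by simp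
      also have "(\<Sum>k\<in>UNIV. l (axis k 1) * (\<Sum>t\<in>?L. gen \<Delta> t $ k * \<psi> (single (m' + single t 1) 1))) =
          (\<Sum>t\<in>?L. (\<Sum>k\<in>UNIV. gen \<Delta> t $ k * l (axis k 1)) * \<psi> (single (m' + single t 1) 1))"
        unfolding sum_distrib_left sum_distrib_right by (subst sum.swap) (simp add: mult_ac)
      also have "\<dots> = (\<Sum>t\<in>?L. l (gen \<Delta> t) * \<psi> (single (m' + single t 1) 1))"
        by (simp only: linear_vec_eq_sum[OF l(1), symmetric])
      \<comment> \<open>On the support only \<open>t = s\<close> survives by the choice of
        \<open>l\<close>; off the support the monomial has one more variable and vanishes by
        induction.\<close>
      also have "\<dots> = (\<Sum>t\<in>?L. if t = s then \<psi> (single m 1) else 0)"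
      proof (rule sum.cong[OF refl])
        fix t
        assume t: "t \<in> ?L"
        have keys_t: "keys (m' + single t 1) = insert t ?\<sigma>"
          by (auto simp: keys_add_nat keys')
        have "\<psi> (single (m' + single t 1) 1) = 0" if "t \<notin> ?\<sigma>"
        proof (rule less.hyps)
          \<comment> \<open>The measure is a truncated difference, and drops strictly because the
            enlarged support still has at most \<open>d\<close> elements.\<close>
          have "card (insert t ?\<sigma>) \<le> mdeg (m' + single t 1)"
            unfolding mdeg_def keys_t[symmetric] card_eq_sum
            by (intro sum_mono) (metis in_keys_iff less_one linorder_not_less)
          then show "d - card (keys (m' + single t 1)) < d - card ?\<sigma>"
            using that by (simp add: keys_t[simplified] d)
          show "keys (m' + single t 1) \<subseteq> ?L" "mdeg (m' + single t 1) = d"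
            using t less.prems(1) unfolding keys_t by (auto simp: d)
        qed
        then show "l (gen \<Delta> t) * \<psi> (single (m' + single t 1) 1) = (if t = s then \<psi> (single m 1) else 0)"
          using s by (cases "t \<in> ?\<sigma>") (auto simp: l(2) m[symmetric] simp del: One_nat_def)
      qed
      also have "\<dots> = \<psi> (single m 1)"
        using s less.prems(1) finite_rays by auto
      finally show ?thesis .
    qed
  qed
  have forms: "single m c \<in> forms ?L d" if "m \<in> keys f" for m c
    using formsD[OF f, of m] that by (auto intro!: forms_single simp: in_keys_iff)
  have "\<psi> (single m (lookup f m)) = 0" if "m \<in> keys f" for m
    using scale[OF forms[OF that, of 1], of "lookup f m"] mono[of m] formsD[OF f, of m] that
    by (simp add: mconst_def mult_single in_keys_iff)
  then have "\<psi> (\<Sum>m\<in>keys f. single m (lookup f m)) = 0"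
    by (subst sum) (simp_all add: forms)
  then show ?thesis
    by (simp add: sum_single_lookup)
qed

text \<open>Differentiating \<open>V\<close> descends to the Chow ring and gives a degree map; by
  \<open>form_functional_eq_0\<close> any other degree map agrees with it. So the description in
  \<open>degree_map\<close> denotes this functional.\<close>

lemma degree_map_volume:
  assumes complex: "linear_complex (rays \<Delta>) (cones \<Delta>) (gen \<Delta>)"
    and V: "is_volume d \<Delta> w V" and f: "f \<in> forms (rays \<Delta>) d"
  shows "apply_diff f V = mconst (degree_map d \<Delta> w (chow_class \<Delta> f))"
proof -
  let ?F = "forms (rays \<Delta>) d"
  \<comment> \<open>The value on a class is computed from an arbitrary homogeneous representative;
    independence of the choice is \<open>apply_diff_eq_if_chow_class_eq\<close>.\<close>
  define \<phi> where "\<phi> = restrict (\<lambda>X. lookup (apply_diff (SOME f. f \<in> ?F \<and> chow_class \<Delta> f = X) V) 0) (chow_part \<Delta> d)"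
  have part: "f \<in> ?F \<Longrightarrow> chow_class \<Delta> f \<in> chow_part \<Delta> d" for f
    by (simp add: chow_part_def)
  have \<phi>: "\<phi> (chow_class \<Delta> f) = lookup (apply_diff f V) 0" if f: "f \<in> ?F" for f
  proof -
    let ?g = "SOME g. g \<in> ?F \<and> chow_class \<Delta> g = chow_class \<Delta> f"
    have g: "?g \<in> ?F \<and> chow_class \<Delta> ?g = chow_class \<Delta> f"
      by (rule someI_ex) (use f in blast)
    have "apply_diff ?g V = apply_diff f V"
      by (rule apply_diff_eq_if_chow_class_eq) (use g f is_volumeD[OF V] in \<open>auto intro: forms_carrier\<close>)
    then show ?thesis
      using part[OF f] by (simp add: \<phi>_def)
  qed
  have carr: "f \<in> ?F \<Longrightarrow> f \<in> carrier (poly_ring (rays \<Delta>))" for f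
    by (rule forms_carrier)
  have mcarr: "mconst c \<in> carrier (poly_ring (rays \<Delta>))" for c
    by (rule forms_carrier[OF forms_mconst])
  interpret linear_complex "rays \<Delta>" "cones \<Delta>" "gen \<Delta>" by fact
  have cone_form: "(\<Prod>s\<in>\<sigma>. mvar s) \<in> ?F" if "\<sigma> \<in> cones \<Delta>" "card \<sigma> = d" for \<sigma>
    using forms_prod_mvar[OF cone_subset[OF that(1)]] that(2) by simp
  have deg: "is_degree_map d \<Delta> w \<phi>"
    unfolding is_degree_map_def
  proof (intro conjI ballI allI impI)
    show "\<phi> \<in> extensional (chow_part \<Delta> d)"
      by (simp add: \<phi>_def)
  next
    fix X Y
    assume "X \<in> chow_part \<Delta> d" "Y \<in> chow_part \<Delta> d"
    then obtain f g where "f \<in> ?F" "g \<in> ?F" "X = chow_class \<Delta> f" "Y = chow_class \<Delta> g"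
      by (auto simp: chow_part_def)
    then show "\<phi> (X \<oplus>\<^bsub>chow_ring \<Delta>\<^esub> Y) = \<phi> X + \<phi> Y"
      by (simp add: carr \<phi> forms_add apply_diff_add_left lookup_add flip: chow_class_add)
  next
    fix c X
    assume "X \<in> chow_part \<Delta> d"
    then obtain f where "f \<in> ?F" "X = chow_class \<Delta> f"
      by (auto simp: chow_part_def)
    then show "\<phi> (chow_class \<Delta> (mconst c) \<otimes>\<^bsub>chow_ring \<Delta>\<^esub> X) = c * \<phi> X"
      by (simp add: carr mcarr \<phi> forms_mconst_mult apply_diff_mult apply_diff_mconst flip: chow_class_mult)
  next
    fix \<sigma>
    assume "\<sigma> \<in> cones \<Delta>" "card \<sigma> = d"
    then show "\<phi> (chow_class \<Delta> (\<Prod>s\<in>\<sigma>. mvar s)) = w \<sigma>"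
      using is_volumeD(4)[OF V] by (simp add: \<phi> cone_form lookup_mconst)
  qed
  have "\<phi>' = \<phi>" if \<phi>': "is_degree_map d \<Delta> w \<phi>'" for \<phi>'
  proof (rule extensionalityI)
    show "\<phi>' \<in> extensional (chow_part \<Delta> d)" "\<phi> \<in> extensional (chow_part \<Delta> d)"
      using \<phi>' deg by (auto simp: is_degree_map_def)
    fix X
    assume "X \<in> chow_part \<Delta> d"
    then obtain f where f: "f \<in> ?F" "X = chow_class \<Delta> f"
      by (auto simp: chow_part_def)
    have add': "\<phi>' (chow_class \<Delta> (f + g)) = \<phi>' (chow_class \<Delta> f) + \<phi>' (chow_class \<Delta> g)"
      and add: "\<phi> (chow_class \<Delta> (f + g)) = \<phi> (chow_class \<Delta> f) + \<phi> (chow_class \<Delta> g)"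
      if "f \<in> ?F" "g \<in> ?F" for f g
      using \<phi>' deg that part by (simp_all add: is_degree_map_def chow_class_add carr)
    have scale': "\<phi>' (chow_class \<Delta> (mconst c * f)) = c * \<phi>' (chow_class \<Delta> f)"
      and scale: "\<phi> (chow_class \<Delta> (mconst c * f)) = c * \<phi> (chow_class \<Delta> f)" if "f \<in> ?F" for c f
      using \<phi>' deg that part by (simp_all add: is_degree_map_def chow_class_mult carr mcarr)
    \<comment> \<open>The difference of two degree maps, pulled back to forms, vanishes on relations
      and on the monomials of top-dimensional cones.\<close>
    have "\<phi>' (chow_class \<Delta> f) - \<phi> (chow_class \<Delta> f) = 0"
    proof (rule form_functional_eq_0[OF complex _ _ _ _ _ f(1)])
      fix f g
      assume fg: "f \<in> ?F" "g \<in> ?F"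
      show "\<phi>' (chow_class \<Delta> (f + g)) - \<phi> (chow_class \<Delta> (f + g)) =
          \<phi>' (chow_class \<Delta> f) - \<phi> (chow_class \<Delta> f) + (\<phi>' (chow_class \<Delta> g) - \<phi> (chow_class \<Delta> g))"
        by (simp add: add add' fg)
    next
      fix c f
      assume f: "f \<in> ?F"
      show "\<phi>' (chow_class \<Delta> (mconst c * f)) - \<phi> (chow_class \<Delta> (mconst c * f)) =
          c * (\<phi>' (chow_class \<Delta> f) - \<phi> (chow_class \<Delta> f))"
        by (simp add: scale scale' f right_diff_distrib)
    next
      have zero: "\<phi>' (chow_class \<Delta> 0) = 0" "\<phi> (chow_class \<Delta> 0) = 0"
        using scale'[of 0 0] scale[of 0 0] by simp_all
      fix f assume f: "f \<in> carrier (poly_ring (rays \<Delta>))"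
      show "\<phi>' (chow_class \<Delta> (f * (\<Prod>s\<in>S. mvar s))) - \<phi> (chow_class \<Delta> (f * (\<Prod>s\<in>S. mvar s))) = 0"
        if "S \<subseteq> rays \<Delta>" "S \<notin> cones \<Delta>" for S
        using chow_class_mult_zero[OF f prod_mvar_carrier[OF that(1)] chow_class_nonface[OF that]] zero by simp
      show "\<phi>' (chow_class \<Delta> (f * theta \<Delta> k)) - \<phi> (chow_class \<Delta> (f * theta \<Delta> k)) = 0" for k
        using chow_class_mult_zero[OF f forms_carrier[OF theta_forms] chow_class_theta] zero by simp
    next
      fix \<sigma>
      assume "\<sigma> \<in> cones \<Delta>" "card \<sigma> = d"
      then show "\<phi>' (chow_class \<Delta> (\<Prod>s\<in>\<sigma>. mvar s)) - \<phi> (chow_class \<Delta> (\<Prod>s\<in>\<sigma>. mvar s)) = 0"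
        using \<phi>' deg by (simp add: is_degree_map_def)
    qed
    then show "\<phi>' X = \<phi> X"
      by (simp add: f(2))
  qed
  then have "degree_map d \<Delta> w = \<phi>"
    unfolding degree_map_def using deg by (intro the_equality)
  then show ?thesis
    using forms_apply_diff_const[OF f is_volumeD(1)[OF V]] \<phi>[OF f] by simp
qed

text \<open>\<open>degree_map_volume\<close> shows that \<open>V\<close> has the defining property,
  and nondegeneracy of the pairing shows that no other form has it.\<close>

lemma mixed_volume_unique:
  assumes complex: "linear_complex (rays \<Delta>) (cones \<Delta>) (gen \<Delta>)"
    and V: "is_volume d \<Delta> w V"
  shows "mixed_volume d \<Delta> w = V"
  unfolding mixed_volume_def
proof (rule the_equality)
  show "V \<in> forms (rays \<Delta>) d \<and>
      (\<forall>f\<in>forms (rays \<Delta>) d. apply_diff f V = mconst (degree_map d \<Delta> w (chow_class \<Delta> f)))"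
    using degree_map_volume[OF assms] is_volumeD(1)[OF V] by blast
  fix W
  assume W: "W \<in> forms (rays \<Delta>) d \<and>
      (\<forall>f\<in>forms (rays \<Delta>) d. apply_diff f W = mconst (degree_map d \<Delta> w (chow_class \<Delta> f)))"
  show "W = V"
  proof (rule apply_diff_forms_unique)
    fix f
    assume "f \<in> forms (rays \<Delta>) d"
    then show "apply_diff f W = apply_diff f V"
      using W degree_map_volume[OF assms, of f] by metis
  qed (use W is_volumeD(1)[OF V] in blast)+
qed

text \<open>Applying \<open>\<theta>\<^sub>k\<close> times the monomial of a codimension-one cone
  \<open>\<tau>\<close> to \<open>V\<close> gives the coordinates of a relation among all
  generators. Its coefficients off \<open>\<tau>\<close> are the weights of the neighbouring cones,
  or 0 at nonfaces, and the rest lies in the span of \<open>\<tau>\<close>.\<close>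

lemma volume_imp_minkowski_weight:
  fixes \<Delta> :: "('v, 'n::finite) fan"
  assumes complex: "linear_complex (rays \<Delta>) (cones \<Delta>) (gen \<Delta>)"
    and V: "is_volume d \<Delta> w V"
  shows "w \<in> minkowski_weights \<Delta> d"
  unfolding minkowski_weights_def
proof (intro CollectI ballI impI)
  interpret linear_complex "rays \<Delta>" "cones \<Delta>" "gen \<Delta>" by fact
  fix \<tau>
  assume \<tau>: "\<tau> \<in> cones \<Delta>" "card \<tau> + 1 = d"
  let ?D = "\<lambda>s. apply_diff (mvar s * (\<Prod>t\<in>\<tau>. mvar t)) V"
  define c where "c s = lookup (?D s) 0" for s
  have "?D s = mconst (c s)" if "s \<in> rays \<Delta>" for s
    unfolding c_def
    using forms_mult[OF forms_mvar[OF that] forms_prod_mvar[OF cone_subset[OF \<tau>(1)]]]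
    by (intro forms_apply_diff_const[OF _ is_volumeD(1)[OF V]]) (simp add: \<tau>(2)[symmetric])
  then have "apply_diff (theta \<Delta> k * (\<Prod>t\<in>\<tau>. mvar t)) V = mconst (\<Sum>s\<in>rays \<Delta>. gen \<Delta> s $ k * c s)" for k
    by (simp add: theta_def sum_distrib_right apply_diff_sum_left mult.assoc apply_diff_mult[of "mconst _"]
        apply_diff_mconst mconst_sum mconst_mult)
  then have "mconst (\<Sum>s\<in>rays \<Delta>. gen \<Delta> s $ k * c s) = (0 :: 'v mpoly)" for k
    by (simp add: apply_diff_mult' is_volumeD(3)[OF V])
  then have "(\<Sum>s\<in>rays \<Delta>. c s *\<^sub>R gen \<Delta> s) = 0"
    by (simp add: vec_eq_iff mconst_eq_0_iff mult.commute)
  then have eq: "(\<Sum>s\<in>rays \<Delta> - \<tau>. c s *\<^sub>R gen \<Delta> s) = - (\<Sum>s\<in>\<tau>. c s *\<^sub>R gen \<Delta> s)"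
    by (simp add: sum.subset_diff[OF cone_subset[OF \<tau>(1)] finite_rays] eq_neg_iff_add_eq_0)
  have c_out: "c s = (if insert s \<tau> \<in> cones \<Delta> then w (insert s \<tau>) else 0)" if s: "s \<in> rays \<Delta> - \<tau>" for s
  proof -
    have "mvar s * (\<Prod>t\<in>\<tau>. mvar t) = (\<Prod>t\<in>insert s \<tau>. mvar t)" "card (insert s \<tau>) = d"
      using s \<tau> finite_cone[OF \<tau>(1)] by auto
    then show ?thesis
      using is_volumeD(2)[OF V, of "insert s \<tau>"] is_volumeD(4)[OF V, of "insert s \<tau>"] s
        cone_subset[OF \<tau>(1)] by (simp add: c_def lookup_mconst)
  qed
  have "(\<Sum>s | s \<in> rays \<Delta> - \<tau> \<and> insert s \<tau> \<in> cones \<Delta>. w (insert s \<tau>) *\<^sub>R gen \<Delta> s) =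
      (\<Sum>s\<in>rays \<Delta> - \<tau>. c s *\<^sub>R gen \<Delta> s)"
    using finite_rays by (intro sum.mono_neutral_cong_left) (auto simp: c_out)
  also have "\<dots> \<in> span (gen \<Delta> ` \<tau>)"
    unfolding eq by (intro span_neg span_sum span_scale span_base) auto
  finally show "(\<Sum>s | s \<in> rays \<Delta> - \<tau> \<and> insert s \<tau> \<in> cones \<Delta>. w (insert s \<tau>) *\<^sub>R gen \<Delta> s)
      \<in> span (gen \<Delta> ` \<tau>)" .
qed

section \<open>Operators depending on a parameter\<close>

text \<open>With \<open>z\<close> counted in degree -1, \<open>F\<close> is homogeneous of order
  \<open>e\<close>. On forms of degree \<open>d\<close> only the coefficients of \<open>z^m\<close>
  with \<open>m \<le> d\<close> can act.\<close>

definition graded :: "nat \<Rightarrow> 'v mpoly fps \<Rightarrow> bool"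
  where "graded e F \<longleftrightarrow> (\<forall>m. fps_nth F m \<in> forms UNIV (m + e))"

lemma graded_diff: "graded e F \<Longrightarrow> graded e G \<Longrightarrow> graded e (F - G)"
  by (simp add: graded_def forms_diff)

lemma graded_const_mult:
  assumes "f \<in> forms UNIV j" "graded e F"
  shows "graded (e + j) (fps_const f * F)"
  unfolding graded_def
proof
  fix m
  have "f * fps_nth F m \<in> forms UNIV (j + (m + e))"
    using assms by (intro forms_mult) (simp_all add: graded_def)
  then show "fps_nth (fps_const f * F) m \<in> forms UNIV (m + (e + j))"
    by (simp add: add_ac)
qed

lemma of_nat_eq_mconst: "of_nat n = mconst (real n)"
  by (simp add: mconst_def)

lemma graded_deriv: "graded e F \<Longrightarrow> graded (e + 1) (fps_deriv F)"
  by (simp only: graded_def fps_deriv_nth of_nat_eq_mconst) (metis add.assoc add.commute forms_mconst_mult)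

lemma apply_diff_mconst_mult: "apply_diff f (mconst c * g) = mconst c * apply_diff f g"
  by (metis apply_diff_mconst apply_diff_mult apply_diff_mult')

lemma apply_op_at_0_right [simp]: "apply_op_at F 0 h = 0"
  by (simp add: apply_op_at_def)

lemma apply_op_at_0_left [simp]: "apply_op_at 0 g h = 0"
  by (simp add: apply_op_at_def)

lemma apply_op_at_const_mult: "apply_op_at (fps_const f * F) g h = apply_op_at F (apply_diff f g) h"
  by (simp add: apply_op_at_def apply_diff_mult')

text \<open>The cut-off \<open>n\<close> is left free so that sums for different operators can share
  a range.\<close>

lemma apply_op_at_graded:
  assumes g: "g \<in> forms L d" and F: "graded e F" and "d \<le> n"
  shows "apply_op_at F g h = (\<Sum>m\<le>n. h ^ m * apply_diff (fps_nth F m) g)"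
proof -
  have "apply_diff (fps_nth F m) g = 0" if "n < m" for m
  proof (rule apply_diff_high[OF _ g])
    fix k
    assume "k \<in> keys (fps_nth F m)"
    then have "mdeg k = m + e"
      using F formsD(2)[of "fps_nth F m" UNIV "m + e" k] by (simp add: graded_def in_keys_iff)
    then show "d < mdeg k"
      using that \<open>d \<le> n\<close> by simp
  qed
  then show ?thesis
    unfolding apply_op_at_def by (intro Sum_any.expand_superset) (auto, metis linorder_not_less mult_zero_right)
qed

lemma apply_op_at_diff:
  assumes "g \<in> forms L d" "graded e F" "graded e G"
  shows "apply_op_at (F - G) g h = apply_op_at F g h - apply_op_at G g h"
  by (simp add: apply_op_at_graded[OF assms(1) assms(2) order_refl]
      apply_op_at_graded[OF assms(1) assms(3) order_refl]
      apply_op_at_graded[OF assms(1) graded_diff[OF assms(2,3)] order_refl]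
      apply_diff_diff_left right_diff_distrib sum_subtractf)

lemma apply_op_at_mconst:
  assumes "graded e F"
  shows "apply_op_at F (mconst c) h = mconst (c * lookup (fps_nth F 0) 0)"
  by (simp add: apply_op_at_graded[OF forms_mconst[of c UNIV] assms order_refl] apply_diff_of_mconst)

text \<open>The chain rule: the derivative falls on \<open>g\<close> or on the polynomial
  substituted for \<open>z\<close>. The sums are cut at \<open>Suc d\<close>, so that after the
  index shift caused by differentiating powers of \<open>h\<close> they end at
  \<open>d\<close>.\<close>

lemma partial_deriv_apply_op_at:
  assumes g: "g \<in> forms L d" and F: "graded e F"
  shows "partial_deriv s (apply_op_at F g h) =
    apply_op_at (fps_const (mvar s) * F) g h + partial_deriv s h * apply_op_at (fps_deriv F) g h"
proof -
  let ?a = "\<lambda>m. apply_diff (fps_nth F m) g"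
  have sF: "graded (e + 1) (fps_const (mvar s) * F)"
    by (rule graded_const_mult[OF forms_mvar F]) simp
  have "partial_deriv s (apply_op_at F g h) =
      (\<Sum>m\<le>Suc d. partial_deriv s (h ^ m) * ?a m) + (\<Sum>m\<le>Suc d. h ^ m * partial_deriv s (?a m))"
    by (simp only: apply_op_at_graded[OF g F le_SucI[OF order_refl]] partial_deriv_sum
        partial_deriv_mult sum.distrib)
  also have "(\<Sum>m\<le>Suc d. h ^ m * partial_deriv s (?a m)) = apply_op_at (fps_const (mvar s) * F) g h"
    by (simp only: apply_op_at_graded[OF g sF le_SucI[OF order_refl]] fps_mult_left_const_nth
        apply_diff_mult apply_diff_mvar)
  also have "(\<Sum>m\<le>Suc d. partial_deriv s (h ^ m) * ?a m) =
      (\<Sum>m\<le>d. partial_deriv s (h ^ Suc m) * ?a (Suc m))"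
    by (subst sum.atMost_Suc_shift) simp
  also have "\<dots> = (\<Sum>m\<le>d. partial_deriv s h * (h ^ m * apply_diff (fps_nth (fps_deriv F) m) g))"
    by (intro sum.cong refl, simp only: partial_deriv_power fps_deriv_nth of_nat_eq_mconst
        apply_diff_mult apply_diff_mconst Suc_eq_plus1[symmetric]) (simp add: mult_ac del: power_Suc)
  also have "\<dots> = partial_deriv s h * apply_op_at (fps_deriv F) g h"
    by (simp only: apply_op_at_graded[OF g graded_deriv[OF F] order_refl] sum_distrib_left)
  finally show ?thesis by (simp add: add.commute)
qed

lemma prod_mvar_apply_op_at:
  assumes g: "g \<in> forms L d" and "finite S" "graded e F" "\<And>s. s \<in> S \<Longrightarrow> partial_deriv s h = 0"
  shows "apply_diff (\<Prod>s\<in>S. mvar s) (apply_op_at F g h) = apply_op_at F (apply_diff (\<Prod>s\<in>S. mvar s) g) h"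
  using assms(2,3,4)
proof (induction S arbitrary: e F rule: finite_induct)
  case (insert s S)
  let ?P = "\<Prod>s\<in>S. mvar s"
  have comm: "apply_diff (mvar s) (apply_diff ?P g) = apply_diff ?P (apply_diff (mvar s) g)"
    by (metis apply_diff_mult apply_diff_mult')
  have "graded (e + 1) (fps_const (mvar s) * F)"
    by (rule graded_const_mult[OF forms_mvar insert.prems(1)]) simp
  then have IH: "apply_diff ?P (apply_op_at (fps_const (mvar s) * F) g h) =
      apply_op_at (fps_const (mvar s) * F) (apply_diff ?P g) h"
    using insert.IH insert.prems by simp
  have "apply_diff (\<Prod>t\<in>insert s S. mvar t) (apply_op_at F g h) =
      apply_diff ?P (apply_op_at (fps_const (mvar s) * F) g h)"
    using insert.hyps insert.prems
    by (simp add: apply_diff_mult' apply_diff_mvar partial_deriv_apply_op_at[OF g])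
  also have "\<dots> = apply_op_at F (apply_diff (\<Prod>t\<in>insert s S. mvar t) g) h"
    unfolding IH using insert.hyps by (simp add: apply_op_at_const_mult apply_diff_mult comm)
  finally show ?case .
qed simp


subsection \<open>The operator \<open>D(p,q)\<close>\<close>

text \<open>The complete homogeneous symmetric polynomial of degree \<open>k\<close> in two
  variables.\<close>

definition hsum :: "'a \<Rightarrow> 'a \<Rightarrow> nat \<Rightarrow> 'a::comm_ring_1"
  where "hsum x y k = (\<Sum>i\<le>k. x ^ i * y ^ (k - i))"

lemma hsum_0 [simp]: "hsum x y 0 = 1"
  by (simp add: hsum_def)

lemma hsum_Suc: "hsum x y (Suc k) = x * hsum x y k + y ^ Suc k"
  unfolding hsum_def by (subst sum.atMost_Suc_shift) (simp add: sum_distrib_left mult_ac)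

lemma hsum_Suc': "hsum x y (Suc k) = y * hsum x y k + x ^ Suc k"
proof -
  have "(\<Sum>i\<le>k. x ^ i * y ^ (Suc k - i)) = (\<Sum>i\<le>k. y * (x ^ i * y ^ (k - i)))"
    by (intro sum.cong) (auto simp: Suc_diff_le mult_ac)
  then show ?thesis
    by (simp add: hsum_def sum_distrib_left)
qed

lemma hsum_recurrence: "hsum x y (Suc (Suc k)) = (x + y) * hsum x y (Suc k) - x * y * hsum x y k"
  using hsum_Suc[of x y "Suc k"] hsum_Suc[of x y k] by (simp add: algebra_simps)

lemma diff_mult_hsum: "(x - y) * hsum x y k = x ^ Suc k - y ^ Suc k"
  using hsum_Suc[of x y k] hsum_Suc'[of x y k] by (simp add: algebra_simps)

lemma sum_pairs_eq_hsum:
  "(\<Sum>(a, b) | 1 \<le> a \<and> 1 \<le> b \<and> a + b = Suc (Suc k). x ^ a * y ^ b) = x * y * hsum x y k"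
proof -
  have "(\<Sum>(a, b) | 1 \<le> a \<and> 1 \<le> b \<and> a + b = Suc (Suc k). x ^ a * y ^ b) =
      (\<Sum>i\<le>k. x ^ Suc i * y ^ Suc (k - i))"
  proof (rule sum.reindex_bij_witness[where i = "\<lambda>i. (Suc i, Suc (k - i))" and j = "\<lambda>(a, b). a - 1"])
    fix c :: "nat \<times> nat"
    assume "c \<in> {(a, b). 1 \<le> a \<and> 1 \<le> b \<and> a + b = Suc (Suc k)}"
    then obtain a b where "c = (Suc a, Suc b)" "a + b = k"
      by (cases c; cases "fst c"; cases "snd c") auto
    then show "(Suc (case c of (a, b) \<Rightarrow> a - 1), Suc (k - (case c of (a, b) \<Rightarrow> a - 1))) = c"
      "(case c of (a, b) \<Rightarrow> a - 1) \<in> {..k}"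
      "x ^ Suc (case c of (a, b) \<Rightarrow> a - 1) * y ^ Suc (k - (case c of (a, b) \<Rightarrow> a - 1)) =
        (case c of (a, b) \<Rightarrow> x ^ a * y ^ b)"
      by auto
  qed auto
  also have "\<dots> = x * y * hsum x y k"
    by (simp add: hsum_def sum_distrib_left mult_ac)
  finally show ?thesis .
qed

lemma hsum_mvar_forms: "hsum (mvar p) (mvar q) k \<in> forms UNIV k"
  unfolding hsum_def
proof (rule forms_sum)
  fix i
  assume "i \<in> {..k}"
  then show "mvar p ^ i * mvar q ^ (k - i) \<in> forms UNIV k"
    using forms_mult[OF forms_power[OF forms_mvar] forms_power[OF forms_mvar], of p UNIV q i "k - i"] by simp
qed

section \<open>Closed form and differential equation of the operator\<close>

lemma D_op_nth:
  "fps_nth (D_op p q) 0 = 1" "fps_nth (D_op p q) (Suc 0) = 0"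
  "fps_nth (D_op p q) (Suc (Suc k)) = - (mconst (1 / fact (Suc (Suc k))) * (mvar p * mvar q * hsum (mvar p) (mvar q) k))"
  by (simp_all add: D_op_def sum_pairs_eq_hsum[unfolded One_nat_def] del: fact_Suc)

text \<open>The quotient formula with its denominator cleared. Coefficientwise it is the telescoping
  identity \<open>diff_mult_hsum\<close>.\<close>

lemma D_op_identity:
  "(fps_const (mvar p) - fps_const (mvar q)) * D_op p q =
    fps_const (mvar p) * exp_z (mvar q) - fps_const (mvar q) * exp_z (mvar p)"
proof (rule fps_ext)
  fix m
  consider "m = 0" | "m = Suc 0" | k where "m = Suc (Suc k)"
    by (metis not0_implies_Suc)
  then show "fps_nth ((fps_const (mvar p) - fps_const (mvar q)) * D_op p q) m =
      fps_nth (fps_const (mvar p) * exp_z (mvar q) - fps_const (mvar q) * exp_z (mvar p)) m"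
  proof cases
    case 3
    let ?x = "mvar p" and ?y = "mvar q" and ?c = "mconst (1 / fact (Suc (Suc k)))"
    have "(?x - ?y) * - (?c * (?x * ?y * hsum ?x ?y k)) = - (?c * (?x * ?y)) * ((?x - ?y) * hsum ?x ?y k)"
      by (simp add: algebra_simps)
    also have "\<dots> = ?x * (?c * ?y ^ Suc (Suc k)) - ?y * (?c * ?x ^ Suc (Suc k))"
      unfolding diff_mult_hsum by (simp add: algebra_simps)
    finally show ?thesis
      by (simp add: 3 D_op_nth exp_z_def fps_const_sub del: fact_Suc power_Suc)
  qed (simp_all add: D_op_nth exp_z_def mult.commute)
qed

text \<open>Since \<open>D(p,q)\<close> is a combination of \<open>e\<^bsup>z\<partial>\<^sub>p\<^esup>\<close> and \<open>e\<^bsup>z\<partial>\<^sub>q\<^esup>\<close>, it is annihilated by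
  \<open>(\<partial>\<^sub>z - \<partial>\<^sub>p)(\<partial>\<^sub>z - \<partial>\<^sub>q)\<close>. The factor \<open>\<partial>\<^sub>p - \<partial>\<^sub>q\<close> cannot simply be cancelled: polynomial
  mappings are an instance of \<open>idom\<close> only for linearly ordered indeterminates. Hence the detour
  through \<open>E\<close> with \<open>\<partial>\<^sub>z D = \<partial>\<^sub>p\<partial>\<^sub>q E\<close>.\<close>

definition E_op :: "'v \<Rightarrow> 'v \<Rightarrow> 'v mpoly fps"
  where "E_op p q = Abs_fps (\<lambda>m. case m of 0 \<Rightarrow> 0 | Suc k \<Rightarrow> - (mconst (1 / fact m) * hsum (mvar p) (mvar q) k))"

lemma E_op_nth [simp]:
  "fps_nth (E_op p q) 0 = 0"
  "fps_nth (E_op p q) (Suc k) = - (mconst (1 / fact (Suc k)) * hsum (mvar p) (mvar q) k)"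
  by (simp_all add: E_op_def)

lemma of_nat_mult_inverse_fact: "of_nat (Suc k) * mconst (1 / fact (Suc k)) = mconst (1 / fact k)"
  by (simp only: of_nat_eq_mconst mconst_mult[symmetric]) (simp add: divide_simps del: of_nat_Suc)

lemma deriv_D_op: "fps_deriv (D_op p q) = fps_const (mvar p * mvar q) * E_op p q"
proof (rule fps_ext)
  fix m
  show "fps_nth (fps_deriv (D_op p q)) m = fps_nth (fps_const (mvar p * mvar q) * E_op p q) m"
  proof (cases m)
    case (Suc k)
    let ?f = "mvar p * mvar q * hsum (mvar p) (mvar q) k"
    have "fps_nth (fps_deriv (D_op p q)) m =
        of_nat (Suc (Suc k)) * - (mconst (1 / fact (Suc (Suc k))) * ?f)"
      by (simp add: Suc D_op_nth del: of_nat_Suc fact_Suc)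
    also have "\<dots> = - (of_nat (Suc (Suc k)) * mconst (1 / fact (Suc (Suc k))) * ?f)"
      by (simp only: mult_minus_right mult.assoc)
    also have "\<dots> = fps_nth (fps_const (mvar p * mvar q) * E_op p q) m"
      unfolding of_nat_mult_inverse_fact by (simp add: Suc mult_ac del: fact_Suc)
    finally show ?thesis .
  qed (simp add: D_op_nth)
qed

lemma deriv_E_op_nth: "fps_nth (fps_deriv (E_op p q)) k = - (mconst (1 / fact k) * hsum (mvar p) (mvar q) k)"
  using of_nat_mult_inverse_fact[of k, where 'a = 'a]
  by (simp add: mult.assoc[symmetric] del: fact_Suc of_nat_Suc)

text \<open>In the coefficient of \<open>z^m\<close>, after removal of \<open>1 / m!\<close>, this
  is \<open>hsum_recurrence\<close>; the cases \<open>m = 0\<close> and \<open>m = 1\<close> are its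
  initial conditions.\<close>

lemma E_op_ode: "fps_deriv (E_op p q) - fps_const (mvar p + mvar q) * E_op p q + D_op p q = 0"
proof (rule fps_ext)
  fix m
  consider "m = 0" | "m = Suc 0" | k where "m = Suc (Suc k)"
    by (metis not0_implies_Suc)
  then show "fps_nth (fps_deriv (E_op p q) - fps_const (mvar p + mvar q) * E_op p q + D_op p q) m = fps_nth 0 m"
  proof cases
    case 2
    then show ?thesis
      by (simp add: D_op_nth deriv_E_op_nth hsum_Suc del: fps_deriv_nth)
  next
    case 3
    then show ?thesis
      by (simp add: D_op_nth deriv_E_op_nth hsum_recurrence algebra_simps del: fps_deriv_nth fact_Suc)
  qed (simp add: D_op_nth deriv_E_op_nth del: fps_deriv_nth)
qed

lemma D_op_ode:
  "fps_deriv (fps_deriv (D_op p q)) - fps_const (mvar p + mvar q) * fps_deriv (D_op p q) +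
    fps_const (mvar p * mvar q) * D_op p q = 0"
proof -
  have "fps_deriv (fps_deriv (D_op p q)) - fps_const (mvar p + mvar q) * fps_deriv (D_op p q) +
      fps_const (mvar p * mvar q) * D_op p q = fps_const (mvar p * mvar q) *
      (fps_deriv (E_op p q) - fps_const (mvar p + mvar q) * E_op p q + D_op p q)"
    by (simp add: deriv_D_op algebra_simps)
  then show ?thesis
    by (simp add: E_op_ode)
qed

lemma graded_D_op: "graded 0 (D_op p q)"
  unfolding graded_def
proof
  fix m
  consider "m = 0" | "m = Suc 0" | k where "m = Suc (Suc k)"
    by (metis not0_implies_Suc)
  then show "fps_nth (D_op p q) m \<in> forms UNIV (m + 0)"
  proof cases
    case 1
    then show ?thesis
      using forms_mconst[of 1] by (simp add: D_op_nth)
  next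
    case 3
    have "mvar p * mvar q * hsum (mvar p) (mvar q) k \<in> forms UNIV (1 + 1 + k)"
      by (intro forms_mult forms_mvar hsum_mvar_forms) simp_all
    then show ?thesis
      unfolding 3 D_op_nth by (intro forms_uminus forms_mconst_mult) simp
  qed (simp add: D_op_nth)
qed

text \<open>The coefficient of \<open>z^m\<close> in \<open>E_op p q\<close> has degree
  \<open>m - 1\<close>, so one factor \<open>mvar s\<close>, or one derivative in \<open>z\<close>,
  brings it to order 0.\<close>

lemma graded_mvar_E_op: "graded 0 (fps_const (mvar s) * E_op p q)"
  unfolding graded_def
proof
  fix m
  show "fps_nth (fps_const (mvar s) * E_op p q) m \<in> forms UNIV (m + 0)"
  proof (cases m)
    case (Suc k)
    have "mvar s * hsum (mvar p) (mvar q) k \<in> forms UNIV (1 + k)"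
      by (intro forms_mult forms_mvar hsum_mvar_forms) simp
    then have "- (mconst (1 / fact (Suc k)) * (mvar s * hsum (mvar p) (mvar q) k)) \<in> forms UNIV (1 + k)"
      by (intro forms_uminus forms_mconst_mult)
    then show ?thesis
      by (simp add: Suc mult.left_commute del: fact_Suc)
  qed simp
qed

lemma graded_deriv_E_op: "graded 0 (fps_deriv (E_op p q))"
  unfolding graded_def deriv_E_op_nth by (simp add: forms_uminus forms_mconst_mult hsum_mvar_forms)

section \<open>Star subdivisions\<close>

lemma star_subdivision_complex:
  fixes \<Delta> :: "('v, 'n::finite) fan"
  assumes fan: "simplicial_fan d \<Delta>" and "p \<noteq> q" and "r \<notin> rays \<Delta>"
  shows "linear_complex (rays (star_subdivision \<Delta> p q r)) (cones (star_subdivision \<Delta> p q r))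
    (gen (star_subdivision \<Delta> p q r))"
proof -
  interpret simplicial_linear_complex "rays \<Delta>" "cones \<Delta>" "gen \<Delta>"
    by (rule simplicial_fan_complex[OF fan])
  let ?g = "(gen \<Delta>)(r := gen \<Delta> p + gen \<Delta> q)"
  \<comment> \<open>Here \<open>x\<close> and \<open>y\<close> are \<open>p\<close> and
    \<open>q\<close> in either order, with \<open>y\<close> missing from
    \<open>\<sigma>\<close>.\<close>
  have new: "inj_on ?g (insert r \<sigma>) \<and> independent (?g ` insert r \<sigma>)"
    if xy: "{x, y} = {p, q}" "x \<noteq> y" "y \<notin> \<sigma>" and \<sigma>: "\<sigma> \<union> {p, q} \<in> cones \<Delta>" for \<sigma> x y
  proof -
    have fin: "finite \<sigma>" and r: "r \<notin> \<sigma>" "r \<noteq> p" "r \<noteq> q"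
      using finite_cone[OF \<sigma>] cone_subset[OF \<sigma>] assms by auto
    have indep: "\<And>c. (\<Sum>s\<in>\<sigma> \<union> {p, q}. c s *\<^sub>R gen \<Delta> s) = 0 \<Longrightarrow> \<forall>s\<in>\<sigma> \<union> {p, q}. c s = 0"
      using inj_independent_iff[OF finite_cone[OF \<sigma>], of "gen \<Delta>"] cone_inj[OF \<sigma>]
        cone_independent[OF \<sigma>] by blast
    have "\<forall>s\<in>insert r \<sigma>. c s = 0" if c: "(\<Sum>s\<in>insert r \<sigma>. c s *\<^sub>R ?g s) = 0" for c
    proof -
      \<comment> \<open>The relation is rewritten in the old generators by splitting the new one
        into those of \<open>p\<close> and \<open>q\<close>. The coefficient at the missing
        \<open>y\<close> is then \<open>c r\<close> alone, so it vanishes first.\<close>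
      define c' where "c' s = (if s \<in> \<sigma> then c s else 0) + (if s \<in> {p, q} then c r else 0)" for s
      have "(\<Sum>s\<in>\<sigma> \<union> {p, q}. c' s *\<^sub>R gen \<Delta> s) =
          (\<Sum>s\<in>\<sigma> \<union> {p, q}. (if s \<in> \<sigma> then c s *\<^sub>R gen \<Delta> s else 0)) +
          (\<Sum>s\<in>\<sigma> \<union> {p, q}. (if s \<in> {p, q} then c r *\<^sub>R gen \<Delta> s else 0))"
        unfolding sum.distrib[symmetric] by (intro sum.cong) (auto simp: c'_def scaleR_add_left)
      also have "(\<Sum>s\<in>\<sigma> \<union> {p, q}. (if s \<in> \<sigma> then c s *\<^sub>R gen \<Delta> s else 0)) = (\<Sum>s\<in>\<sigma>. c s *\<^sub>R gen \<Delta> s)"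
        using fin by (intro sum.mono_neutral_cong_right) auto
      also have "(\<Sum>s\<in>\<sigma> \<union> {p, q}. (if s \<in> {p, q} then c r *\<^sub>R gen \<Delta> s else 0)) =
          (\<Sum>s\<in>{p, q}. c r *\<^sub>R gen \<Delta> s)"
        using fin by (intro sum.mono_neutral_cong_right) auto
      also have "(\<Sum>s\<in>{p, q}. c r *\<^sub>R gen \<Delta> s) = c r *\<^sub>R ?g r"
        using \<open>p \<noteq> q\<close> by (simp add: scaleR_add_right)
      also have "(\<Sum>s\<in>\<sigma>. c s *\<^sub>R gen \<Delta> s) = (\<Sum>s\<in>\<sigma>. c s *\<^sub>R ?g s)"
        using r by (intro sum.cong) auto
      also have "(\<Sum>s\<in>\<sigma>. c s *\<^sub>R ?g s) + c r *\<^sub>R ?g r = 0"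
        using c fin r by (simp add: add.commute)
      finally have zero: "\<forall>s\<in>\<sigma> \<union> {p, q}. c' s = 0"
        by (rule indep)
      have "y \<in> {p, q}"
        using xy(1) by blast
      then have "c r = 0"
        using zero xy(3) by (auto simp: c'_def)
      moreover from this have "c' s = c s" if "s \<in> \<sigma>" for s
        using that by (simp add: c'_def)
      ultimately show ?thesis
        using zero by auto
    qed
    then show ?thesis
      using inj_independent_iff[of "insert r \<sigma>" ?g] fin by blast
  qed
  have star: "rays (star_subdivision \<Delta> p q r) = insert r (rays \<Delta>)"
    "gen (star_subdivision \<Delta> p q r) = ?g"
    by (simp_all add: star_subdivision_def)
  have old: "inj_on ?g \<sigma> \<and> independent (?g ` \<sigma>)" if \<sigma>: "\<sigma> \<in> cones \<Delta>" for \<sigma>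
  proof -
    have "r \<notin> \<sigma>"
      using cone_subset[OF \<sigma>] assms by auto
    then have "?g s = gen \<Delta> s" if "s \<in> \<sigma>" for s
      using that by auto
    then have "inj_on ?g \<sigma> \<longleftrightarrow> inj_on (gen \<Delta>) \<sigma>" "?g ` \<sigma> = gen \<Delta> ` \<sigma>"
      by (intro inj_on_cong image_cong; simp)+
    then show ?thesis
      using cone_inj[OF \<sigma>] cone_independent[OF \<sigma>] by simp
  qed
  have ind: "inj_on ?g \<sigma>' \<and> independent (?g ` \<sigma>')" if cone: "\<sigma>' \<in> cones (star_subdivision \<Delta> p q r)" for \<sigma>'
  proof -
    consider "\<sigma>' \<in> cones \<Delta>"
      | \<sigma> where "\<sigma>' = insert r \<sigma>" "\<not> {p, q} \<subseteq> \<sigma>" "\<sigma> \<union> {p, q} \<in> cones \<Delta>"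
      using cone by (auto simp: star_subdivision_def)
    then show ?thesis
    proof cases
      case 2
      then show ?thesis
        using new[of p q \<sigma>] new[of q p \<sigma>] \<open>p \<noteq> q\<close> by blast
    qed (rule old)
  qed
  show ?thesis
    unfolding star
  proof
    show "finite (insert r (rays \<Delta>))"
      using finite_rays by simp
    show "\<sigma>' \<subseteq> insert r (rays \<Delta>)" if "\<sigma>' \<in> cones (star_subdivision \<Delta> p q r)" for \<sigma>'
      using that cone_subset by (auto simp: star_subdivision_def)
  qed (use ind in blast)+
qed

section \<open>Weights of the top-dimensional cones of the subdivision\<close>

lemma subdivided_weight_old:
  assumes fan: "simplicial_fan d \<Delta>" and "r \<notin> rays \<Delta>" and \<sigma>: "\<sigma> \<in> cones \<Delta>" "card \<sigma> = d"
  shows "subdivided_weight d \<Delta> p q r w \<sigma> = w \<sigma>"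
proof -
  interpret simplicial_linear_complex "rays \<Delta>" "cones \<Delta>" "gen \<Delta>"
    by (rule simplicial_fan_complex[OF fan])
  have r: "r \<notin> \<sigma>"
    using cone_subset[OF \<sigma>(1)] assms(2) by auto
  have "(THE \<tau>. \<tau> \<in> cones \<Delta> \<and> card \<tau> = d \<and> lies_in p q r \<sigma> \<tau>) = \<sigma>"
  proof (rule the_equality)
    show "\<sigma> \<in> cones \<Delta> \<and> card \<sigma> = d \<and> lies_in p q r \<sigma> \<sigma>"
      using \<sigma> r by (auto simp: lies_in_def)
    show "\<tau> = \<sigma>" if "\<tau> \<in> cones \<Delta> \<and> card \<tau> = d \<and> lies_in p q r \<sigma> \<tau>" for \<tau>
      using that \<sigma>(2) r finite_cone[of \<tau>] card_subset_eq[of \<tau> \<sigma>] by (auto simp: lies_in_def)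
  qed
  then show ?thesis
    by (simp add: subdivided_weight_def)
qed

text \<open>Every cone in which \<open>insert r \<sigma>\<close> lies contains
  \<open>\<sigma> \<union> {p, q}\<close>, and equal cardinality forces equality.\<close>

lemma subdivided_weight_new:
  assumes fan: "simplicial_fan d \<Delta>" and "r \<notin> rays \<Delta>"
    and \<sigma>: "\<sigma> \<union> {p, q} \<in> cones \<Delta>" "card (\<sigma> \<union> {p, q}) = d"
  shows "subdivided_weight d \<Delta> p q r w (insert r \<sigma>) = w (\<sigma> \<union> {p, q})"
proof -
  interpret simplicial_linear_complex "rays \<Delta>" "cones \<Delta>" "gen \<Delta>"
    by (rule simplicial_fan_complex[OF fan])
  have r: "r \<notin> \<sigma>"
    using cone_subset[OF \<sigma>(1)] assms(2) by auto
  have "(THE \<tau>. \<tau> \<in> cones \<Delta> \<and> card \<tau> = d \<and> lies_in p q r (insert r \<sigma>) \<tau>) = \<sigma> \<union> {p, q}"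
  proof (rule the_equality)
    show "\<sigma> \<union> {p, q} \<in> cones \<Delta> \<and> card (\<sigma> \<union> {p, q}) = d \<and> lies_in p q r (insert r \<sigma>) (\<sigma> \<union> {p, q})"
      using \<sigma> by (auto simp: lies_in_def)
    show "\<tau> = \<sigma> \<union> {p, q}" if "\<tau> \<in> cones \<Delta> \<and> card \<tau> = d \<and> lies_in p q r (insert r \<sigma>) \<tau>" for \<tau>
    proof -
      have "\<sigma> \<union> {p, q} \<subseteq> \<tau>"
        using that r by (auto simp: lies_in_def)
      then show ?thesis
        using that \<sigma>(2) finite_cone[of \<tau>] card_subset_eq[of \<tau> "\<sigma> \<union> {p, q}"] by auto
    qed
  qed
  then show ?thesis
    by (simp add: subdivided_weight_def)
qed

section \<open>Differential equations after the substitution for \<open>z\<close>\<close>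

locale subdivided_volume =
  fixes L :: "'v set" and V :: "'v mpoly" and d :: nat and p q r :: 'v
  assumes V: "V \<in> forms L d" and finite_L: "finite L"
    and distinct: "p \<noteq> q" "p \<in> L" "q \<in> L" "r \<notin> L"
begin

abbreviation (input) h where "h \<equiv> mvar r - mvar p - mvar q"

abbreviation (input) A where "A F \<equiv> apply_op_at F V h"

lemma partial_deriv_h: "partial_deriv s h = (if s = r then 1 else if s \<in> {p, q} then - 1 else 0)"
  using distinct by (auto simp: partial_deriv_diff partial_deriv_mvar)

lemma deriv_old:
  assumes "graded e F" "s \<in> {p, q}"
  shows "apply_diff (mvar s) (A F) = A (fps_const (mvar s) * F - fps_deriv F)"
proof -
  have "graded (e + 1) (fps_const (mvar s) * F)"
    by (rule graded_const_mult[OF forms_mvar assms(1)]) simp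
  moreover have "partial_deriv s h = - 1"
    using assms(2) distinct unfolding partial_deriv_h by auto
  ultimately show ?thesis
    by (simp only: apply_diff_mvar partial_deriv_apply_op_at[OF V assms(1)]
        apply_op_at_diff[OF V _ graded_deriv[OF assms(1)]]) simp
qed

lemma deriv_new:
  assumes "graded e F"
  shows "apply_diff (mvar r) (A F) = A (fps_deriv F)"
proof -
  \<comment> \<open>As \<open>x\<^sub>r\<close> does not occur in \<open>V\<close>, only the
    substitution contributes.\<close>
  have "partial_deriv r V = 0"
  proof (rule poly_mapping_eqI)
    fix m
    have "lookup V (m + single r 1) = 0"
      using formsD(1)[OF V, of "m + single r 1"] distinct(4) by (auto simp: keys_add_nat)
    then show "lookup (partial_deriv r V) m = lookup 0 m"
      by (simp add: lookup_partial_deriv)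
  qed
  then show ?thesis
    by (simp add: apply_diff_mvar partial_deriv_apply_op_at[OF V assms] partial_deriv_h
        apply_op_at_const_mult)
qed

lemma deriv_rest:
  assumes "graded e F" "S \<subseteq> insert r L"
  shows "apply_diff (\<Prod>s\<in>S - {p, q, r}. mvar s) (A F) = A (fps_const (\<Prod>s\<in>S - {p, q, r}. mvar s) * F)"
  unfolding apply_op_at_const_mult
  by (rule prod_mvar_apply_op_at[OF V _ assms(1)])
    (use finite_subset[OF assms(2)] finite_L partial_deriv_h in auto)

lemma prod_split:
  assumes "S \<subseteq> insert r L"
  shows "(\<Prod>s\<in>S. mvar s :: 'v mpoly) = (\<Prod>s\<in>S - {p, q, r}. mvar s) * (\<Prod>s\<in>S \<inter> {p, q, r}. mvar s)"
proof -
  have "finite S"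
    using finite_subset[OF assms] finite_L by simp
  then show ?thesis
    by (metis mult.commute prod.Int_Diff)
qed

abbreviation (input) D where "D \<equiv> D_op p q"
abbreviation (input) E where "E \<equiv> E_op p q"
abbreviation (input) R where "R \<equiv> A D"

lemma volume_forms: "R \<in> forms (insert r L) d"
  unfolding apply_op_at_graded[OF V graded_D_op order_refl]
proof (rule forms_sum)
  fix m
  assume m: "m \<in> {..d}"
  have "h \<in> forms (insert r L) 1"
    using distinct by (intro forms_diff forms_mvar) auto
  then have 1: "h ^ m \<in> forms (insert r L) m"
    using forms_power[of h _ 1 m] by simp
  have "fps_nth D m \<in> forms UNIV m"
    using graded_D_op[of p q] by (simp add: graded_def)
  then have "apply_diff (fps_nth D m) V \<in> forms L (d - m)"
    using m V by (intro forms_apply_diff[of _ UNIV m]) auto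
  then have "apply_diff (fps_nth D m) V \<in> forms (insert r L) (d - m)"
    using forms_mono[of L "insert r L"] by blast
  from forms_mult[OF 1 this] show "h ^ m * apply_diff (fps_nth D m) V \<in> forms (insert r L) d"
    using m by simp
qed

text \<open>On the substituted polynomial \<open>\<partial>\<^sub>p \<partial>\<^sub>q\<close> acts
  as \<open>(\<partial>\<^sub>q - \<partial>\<^sub>z)(\<partial>\<^sub>p -
  \<partial>\<^sub>z)\<close> on the operator, which is \<open>D_op_ode\<close>.\<close>

lemma volume_diagonal:
  assumes S: "S \<subseteq> insert r L" "{p, q} \<subseteq> S"
  shows "apply_diff (\<Prod>s\<in>S. mvar s) R = 0"
proof -
  have fin: "finite S"
    using finite_subset[OF S(1)] finite_L by simp
  have "(\<Prod>s\<in>S. mvar s :: 'v mpoly) = (\<Prod>s\<in>S - {p, q}. mvar s) * (mvar q * mvar p)"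
    using prod.subset_diff[OF S(2) fin, of mvar] distinct(1) by (simp add: mult.commute)
  moreover have "apply_diff (mvar q * mvar p) R = 0"
  proof -
    have 1: "graded (0 + 1) (fps_const (mvar p) * D - fps_deriv D)"
      by (intro graded_diff graded_const_mult forms_mvar graded_deriv graded_D_op) simp
    have "apply_diff (mvar q * mvar p) R =
        A (fps_const (mvar q) * (fps_const (mvar p) * D - fps_deriv D) -
          fps_deriv (fps_const (mvar p) * D - fps_deriv D))"
      by (simp add: apply_diff_mult deriv_old[OF graded_D_op] deriv_old[OF 1])
    also have "fps_const (mvar q) * (fps_const (mvar p) * D - fps_deriv D) -
        fps_deriv (fps_const (mvar p) * D - fps_deriv D) =
      fps_deriv (fps_deriv D) - fps_const (mvar p + mvar q) * fps_deriv D + fps_const (mvar p * mvar q) * D"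
      by (simp add: algebra_simps flip: fps_const_mult fps_const_add)
    finally show ?thesis
      by (simp add: D_op_ode)
  qed
  ultimately show ?thesis
    by (simp add: apply_diff_mult)
qed

text \<open>\<open>S'\<close> consists of the old rays needed to contain \<open>S\<close>. Factoring
  through the derivative of \<open>V\<close> by \<open>S'\<close> gives 0 if \<open>S'\<close> is a
  nonface, and if \<open>S'\<close> is a top-dimensional cone only the constant coefficient of
  \<open>F\<close> matters. If \<open>r\<close> is in \<open>S\<close> but \<open>p\<close> and
  \<open>q\<close> are not, then \<open>S'\<close> has one element more than \<open>S\<close>, so no
  normalisation of \<open>F\<close> is claimed.\<close>

lemma volume_off_diagonal:
  assumes S: "S \<subseteq> insert r L" "\<not> {p, q} \<subseteq> S"
  defines "S' \<equiv> if r \<in> S then S - {r} \<union> {p, q} else S"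
  shows "\<exists>F. apply_diff (\<Prod>s\<in>S. mvar s) R = apply_op_at F (apply_diff (\<Prod>s\<in>S'. mvar s) V) h \<and>
    (r \<in> S \<longrightarrow> S \<inter> {p, q} \<noteq> {} \<longrightarrow> graded 0 F \<and> lookup (fps_nth F 0) 0 = 1) \<and>
    (r \<notin> S \<longrightarrow> graded 0 F \<and> lookup (fps_nth F 0) 0 = 1)"
proof -
  let ?T = "S - {p, q, r}" and ?P = "\<Prod>s\<in>S - {p, q, r}. mvar s :: 'v mpoly"
  have fin: "finite ?T"
    using finite_subset[OF S(1)] finite_L by simp
  have rpq: "r \<noteq> p" "r \<noteq> q"
    using distinct by auto
  \<comment> \<open>One of \<open>p\<close>, \<open>q\<close> is missing from \<open>S\<close>;
    naming it \<open>y\<close> treats both cases together.\<close>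
  obtain x y where xy: "{x, y} = {p, q}" "x \<noteq> y" "y \<notin> S"
    using S(2) distinct(1) by (metis insert_commute insert_subset empty_subsetI)
  have xy_cases: "x = p \<and> y = q \<or> x = q \<and> y = p"
    using xy(1,2) by (auto simp: doubleton_eq_iff)
  have x: "x \<in> {p, q}" and rx: "r \<noteq> x" "r \<noteq> y"
    using xy_cases rpq by blast+
  have E: "fps_deriv D = fps_const (mvar x * mvar y) * E"
    using xy_cases by (auto simp: deriv_D_op mult.commute)
  have E0: "fps_nth E 0 = 0" "fps_nth (fps_deriv E) 0 = - 1"
    by (simp_all add: deriv_E_op_nth del: fps_deriv_nth)
  have P: "(\<Prod>s\<in>?T \<union> U. mvar s) = ?P * (\<Prod>s\<in>U. mvar s)" if "U \<subseteq> {p, q, r}" for U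
    using fin that finite_subset[OF that] by (intro prod.union_disjoint) auto
  have step: "apply_diff (\<Prod>s\<in>S. mvar s) R = A (fps_const ?P * G)"
    if "apply_diff (\<Prod>s\<in>S \<inter> {p, q, r}. mvar s) R = A G" "graded e G" for G e
    unfolding prod_split[OF S(1)] apply_diff_mult that(1) by (rule deriv_rest[OF that(2) S(1)])
  have gx: "graded (0 + 1) (fps_const (mvar x) * D - fps_deriv D)"
    by (intro graded_diff graded_const_mult forms_mvar graded_deriv graded_D_op) simp
  consider "x \<notin> S" "r \<notin> S" | "x \<in> S" "r \<notin> S" | "x \<notin> S" "r \<in> S" | "x \<in> S" "r \<in> S"
    by blast
  then show ?thesis
  proof cases
    case 1
    then have "S \<inter> {p, q, r} = {}" "S' = ?T \<union> {}"
      using xy_cases xy(3) unfolding S'_def by (elim disjE conjE; auto)+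
    then have "apply_diff (\<Prod>s\<in>S. mvar s) R = A (fps_const (\<Prod>s\<in>S'. mvar s) * D)"
      using step[OF _ graded_D_op] by simp
    then show ?thesis
      using 1 graded_D_op[of p q] by (auto simp: apply_op_at_const_mult D_op_nth)
  next
    case 2
    then have S_eq: "S \<inter> {p, q, r} = {x}" "S' = ?T \<union> {x}"
      using xy_cases xy(3) unfolding S'_def by (elim disjE conjE; auto)+
    \<comment> \<open>From \<open>\<partial>\<^sub>x D - \<partial>\<^sub>z D\<close> with
      \<open>\<partial>\<^sub>z D = \<partial>\<^sub>x \<partial>\<^sub>y E\<close>, the factor
      \<open>\<partial>\<^sub>x\<close> is taken out.\<close>
    let ?F = "D - fps_const (mvar y) * E"
    have "apply_diff (\<Prod>s\<in>S. mvar s) R = A (fps_const ?P * (fps_const (mvar x) * D - fps_deriv D))"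
      by (rule step[OF _ gx]) (simp add: S_eq(1) deriv_old[OF graded_D_op x])
    also have "fps_const ?P * (fps_const (mvar x) * D - fps_deriv D) = fps_const (\<Prod>s\<in>S'. mvar s) * ?F"
      unfolding S_eq(2) E using x by (subst P) (auto simp: algebra_simps simp flip: fps_const_mult)
    finally have "apply_diff (\<Prod>s\<in>S. mvar s) R = apply_op_at ?F (apply_diff (\<Prod>s\<in>S'. mvar s) V) h"
      by (simp add: apply_op_at_const_mult)
    moreover have "graded 0 ?F"
      by (intro graded_diff graded_D_op graded_mvar_E_op)
    moreover have "lookup (fps_nth ?F 0) 0 = 1"
      by (simp add: D_op_nth E0)
    ultimately show ?thesis
      using 2(2) by blast
  next
    case 3
    then have S_eq: "S \<inter> {p, q, r} = {r}" "S' = ?T \<union> {x, y}" "S \<inter> {p, q} = {}"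
      using xy_cases xy(3) rx distinct(1) unfolding S'_def by (elim disjE conjE; auto)+
    have "apply_diff (\<Prod>s\<in>S. mvar s) R = A (fps_const ?P * fps_deriv D)"
      by (rule step[OF _ graded_deriv[OF graded_D_op]]) (simp add: S_eq(1) deriv_new[OF graded_D_op])
    also have "fps_const ?P * fps_deriv D = fps_const (\<Prod>s\<in>S'. mvar s) * E"
    proof (unfold S_eq(2) E, subst P)
      show "{x, y} \<subseteq> {p, q, r}"
        using xy(1) by simp
    qed (use xy(2) in \<open>simp add: mult_ac flip: fps_const_mult\<close>)
    finally show ?thesis
      using 3(2) S_eq(3) by (auto simp: apply_op_at_const_mult)
  next
    case 4
    then have S_eq: "S \<inter> {p, q, r} = {r, x}" "S' = ?T \<union> {x, y}"
      using xy_cases xy(3) rx distinct(1) unfolding S'_def by (elim disjE conjE; auto)+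
    \<comment> \<open>Now \<open>\<partial>\<^sub>z (\<partial>\<^sub>x D - \<partial>\<^sub>z
      D)\<close> contains the factor \<open>\<partial>\<^sub>x \<partial>\<^sub>y\<close>. The
      constant coefficient 1 comes from \<open>- fps_deriv E\<close>, since \<open>E\<close> itself
      starts at \<open>z\<close>.\<close>
    let ?F = "fps_const (mvar x) * E - fps_deriv E"
    have "apply_diff (\<Prod>s\<in>S. mvar s) R = A (fps_const ?P * fps_deriv (fps_const (mvar x) * D - fps_deriv D))"
      by (rule step[OF _ graded_deriv[OF gx]])
        (simp add: S_eq(1) rx apply_diff_mult deriv_old[OF graded_D_op x] deriv_new[OF gx])
    also have "fps_const ?P * fps_deriv (fps_const (mvar x) * D - fps_deriv D) =
        fps_const (\<Prod>s\<in>S'. mvar s) * ?F"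
    proof (unfold S_eq(2), subst P)
      show "{x, y} \<subseteq> {p, q, r}"
        using xy(1) by simp
    qed (use xy(2) in \<open>simp add: E algebra_simps flip: fps_const_mult\<close>)
    finally have "apply_diff (\<Prod>s\<in>S. mvar s) R = apply_op_at ?F (apply_diff (\<Prod>s\<in>S'. mvar s) V) h"
      by (simp add: apply_op_at_const_mult)
    moreover have "graded 0 ?F"
      by (intro graded_diff graded_mvar_E_op graded_deriv_E_op)
    moreover have "lookup (fps_nth ?F 0) 0 = 1"
      by (simp add: E0 del: fps_deriv_nth)
    ultimately show ?thesis
      using 4(2) by blast
  qed
qed

text \<open>Apart from the old relation inside the operator, \<open>\<partial>\<^sub>p\<close> and
  \<open>\<partial>\<^sub>q\<close> each contribute \<open>- \<partial>\<^sub>z D\<close> and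
  \<open>\<partial>\<^sub>r\<close> contributes \<open>\<partial>\<^sub>z D\<close>; these cancel
  because \<open>c r = c p + c q\<close>.\<close>

lemma volume_linear:
  assumes "(\<Sum>s\<in>L. mconst (c s) * partial_deriv s V) = 0" and c: "c r = c p + c q"
  shows "(\<Sum>s\<in>insert r L. mconst (c s) * partial_deriv s R) = 0"
proof -
  have sub: "{p, q} \<subseteq> L"
    using distinct by auto
  have old: "partial_deriv s R = apply_op_at D (partial_deriv s V) h - (if s \<in> {p, q} then A (fps_deriv D) else 0)"
    if "s \<in> L" for s
  proof -
    have "partial_deriv s h = (if s \<in> {p, q} then - 1 else 0)"
      using that distinct unfolding partial_deriv_h by auto
    then show ?thesis
      by (simp add: partial_deriv_apply_op_at[OF V graded_D_op] apply_op_at_const_mult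
          apply_diff_mvar)
  qed
  have new: "partial_deriv r R = A (fps_deriv D)"
    using deriv_new[OF graded_D_op] by (simp add: apply_diff_mvar)
  \<comment> \<open>Reading the expression as an operator of order 1 on \<open>V\<close> gives the
    same cut-off \<open>d\<close> for every \<open>s\<close>, without a case distinction at
    \<open>d = 0\<close>.\<close>
  have trunc: "apply_op_at D (partial_deriv s V) h = (\<Sum>m\<le>d. h ^ m * apply_diff (fps_nth D m) (partial_deriv s V))" for s
  proof -
    have "graded (0 + 1) (fps_const (mvar s) * D)"
      by (rule graded_const_mult[OF forms_mvar graded_D_op]) simp
    from apply_op_at_graded[OF V this order_refl, of h] show ?thesis
      by (simp add: apply_op_at_const_mult apply_diff_mvar apply_diff_mult')
  qed
  have "(\<Sum>s\<in>L. mconst (c s) * apply_op_at D (partial_deriv s V) h) =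
      (\<Sum>m\<le>d. h ^ m * apply_diff (fps_nth D m) (\<Sum>s\<in>L. mconst (c s) * partial_deriv s V))"
    by (simp only: trunc sum_distrib_left apply_diff_sum_right apply_diff_mconst_mult, subst sum.swap)
      (simp add: mult_ac)
  then have "(\<Sum>s\<in>L. mconst (c s) * apply_op_at D (partial_deriv s V) h) = 0"
    by (simp add: assms(1))
  moreover have "(\<Sum>s\<in>L. mconst (c s) * (if s \<in> {p, q} then A (fps_deriv D) else 0)) =
      (\<Sum>s\<in>{p, q}. mconst (c s) * A (fps_deriv D))"
    using sub finite_L by (intro sum.mono_neutral_cong_right) auto
  moreover have "(\<Sum>s\<in>L. mconst (c s) * partial_deriv s R) =
      (\<Sum>s\<in>L. mconst (c s) * apply_op_at D (partial_deriv s V) h) -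
      (\<Sum>s\<in>L. mconst (c s) * (if s \<in> {p, q} then A (fps_deriv D) else 0))"
    unfolding sum_subtractf[symmetric] right_diff_distrib[symmetric]
    by (rule sum.cong[OF refl]) (simp only: old)
  ultimately have "(\<Sum>s\<in>L. mconst (c s) * partial_deriv s R) = - (mconst (c r) * A (fps_deriv D))"
    using distinct(1) by (simp add: c mconst_add distrib_right)
  then show ?thesis
    using finite_L distinct(4) new by simp
qed

end

lemma volume_star_subdivision:
  fixes \<Delta> :: "('v, 'n::finite) fan"
  assumes fan: "simplicial_fan d \<Delta>" and vol: "is_volume d \<Delta> w V"
    and pq: "p \<noteq> q" "{p, q} \<in> cones \<Delta>" and r: "r \<notin> rays \<Delta>"
  shows "is_volume d (star_subdivision \<Delta> p q r) (subdivided_weight d \<Delta> p q r w)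
    (apply_op_at (D_op p q) V (mvar r - mvar p - mvar q))"
proof -
  interpret simplicial_linear_complex "rays \<Delta>" "cones \<Delta>" "gen \<Delta>"
    by (rule simplicial_fan_complex[OF fan])
  interpret subdivided_volume "rays \<Delta>" V d p q r
    using pq r cone_subset[OF pq(2)] is_volumeD(1)[OF vol] finite_rays by unfold_locales auto
  let ?R = "apply_op_at (D_op p q) V (mvar r - mvar p - mvar q)"
  have rays: "rays (star_subdivision \<Delta> p q r) = insert r (rays \<Delta>)"
    by (simp add: star_subdivision_def)
  have "apply_diff (\<Prod>s\<in>S. mvar s) ?R = 0"
    if S: "S \<subseteq> insert r (rays \<Delta>)" "S \<notin> cones (star_subdivision \<Delta> p q r)" for S
  proof (cases "{p, q} \<subseteq> S")
    case False
    let ?S' = "if r \<in> S then S - {r} \<union> {p, q} else S"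
    \<comment> \<open>Otherwise \<open>S\<close> would be a cone of the subdivision, either as an
      old cone without \<open>{p, q}\<close> or in the form
      \<open>insert r (S - {r})\<close>.\<close>
    have "?S' \<notin> cones \<Delta>"
    proof
      assume S': "?S' \<in> cones \<Delta>"
      show False
      proof (cases "r \<in> S")
        case True
        have "\<not> {p, q} \<subseteq> S - {r}" "S - {r} \<union> {p, q} \<in> cones \<Delta>"
          using False S' True by (blast, simp)
        then have "insert r (S - {r}) \<in> cones (star_subdivision \<Delta> p q r)"
          unfolding star_subdivision_def fan.simps by blast
        then show False
          using S(2) True by (simp add: insert_absorb)
      next
        case r: False
        then show False
          using False S' S(2) by (simp add: star_subdivision_def)
      qed
    qed
    moreover have "?S' \<subseteq> rays \<Delta>"
      using S(1) distinct by auto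
    ultimately have "apply_diff (\<Prod>s\<in>?S'. mvar s) V = 0"
      using is_volumeD(2)[OF vol] by blast
    then show ?thesis
      using volume_off_diagonal[OF S(1) False] by auto
  qed (rule volume_diagonal[OF S(1)])
  moreover have "apply_diff (theta (star_subdivision \<Delta> p q r) k) ?R = 0" for k
  proof -
    let ?c = "\<lambda>s. ((gen \<Delta>)(r := gen \<Delta> p + gen \<Delta> q)) s $ k"
    have "(\<Sum>s\<in>rays \<Delta>. mconst (?c s) * partial_deriv s V) = apply_diff (theta \<Delta> k) V"
      using r by (auto simp: theta_def apply_diff_sum_left apply_diff_mult apply_diff_mconst apply_diff_mvar
          intro!: sum.cong)
    then have "(\<Sum>s\<in>insert r (rays \<Delta>). mconst (?c s) * partial_deriv s ?R) = 0"
      using distinct is_volumeD(3)[OF vol] by (intro volume_linear) auto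
    then show ?thesis
      by (simp add: theta_def rays apply_diff_sum_left apply_diff_mult apply_diff_mconst apply_diff_mvar)
        (simp add: star_subdivision_def)
  qed
  moreover have "apply_diff (\<Prod>s\<in>\<sigma>'. mvar s) ?R = mconst (subdivided_weight d \<Delta> p q r w \<sigma>')"
    if \<sigma>': "\<sigma>' \<in> cones (star_subdivision \<Delta> p q r)" "card \<sigma>' = d" for \<sigma>'
  proof -
    consider "\<sigma>' \<in> cones \<Delta>" "\<not> {p, q} \<subseteq> \<sigma>'"
      | \<sigma> where "\<sigma>' = insert r \<sigma>" "\<not> {p, q} \<subseteq> \<sigma>" "\<sigma> \<union> {p, q} \<in> cones \<Delta>"
      using \<sigma>'(1) by (auto simp: star_subdivision_def)
    then show ?thesis
    proof cases
      case 1
      then have "r \<notin> \<sigma>'" "\<sigma>' \<subseteq> insert r (rays \<Delta>)"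
        using cone_subset[OF 1(1)] r by auto
      then show ?thesis
        \<comment> \<open>The derivative of \<open>V\<close> is the constant
          \<open>w \<sigma>'\<close>, so \<open>F\<close> acts through its constant coefficient
          1.\<close>
        using volume_off_diagonal[of \<sigma>'] 1 is_volumeD(4)[OF vol 1(1) \<sigma>'(2)]
          subdivided_weight_old[OF fan r 1(1) \<sigma>'(2)] by (auto simp: apply_op_at_mconst)
    next
      case 2
      have sub: "\<sigma> \<union> {p, q} \<subseteq> rays \<Delta>" and fin: "finite \<sigma>"
        using cone_subset[OF 2(3)] finite_cone[OF 2(3)] by auto
      then have r\<sigma>: "r \<notin> \<sigma>"
        using r by auto
      have le: "card (\<sigma> \<union> {p, q}) \<le> d"
        using fan 2(3) by (simp add: simplicial_fan_def)
      have card: "card \<sigma> + 1 = d"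
        using \<sigma>'(2) 2(1) r\<sigma> fin by simp
      \<comment> \<open>A top-dimensional new cone uses \<open>d - 1\<close> old rays. If these
        avoided both \<open>p\<close> and \<open>q\<close>, adding the two would give a cone with
        \<open>d + 1\<close> rays.\<close>
      have meet: "\<sigma> \<inter> {p, q} \<noteq> {}"
      proof
        assume "\<sigma> \<inter> {p, q} = {}"
        then have "card (\<sigma> \<union> {p, q}) = card \<sigma> + 2"
          using fin pq(1) by (simp add: card_Un_disjoint)
        then show False
          using le card by simp
      qed
      have "\<sigma> \<subset> \<sigma> \<union> {p, q}"
        using 2(2) by blast
      then have "card \<sigma> < card (\<sigma> \<union> {p, q})"
        using fin by (intro psubset_card_mono) auto
      then have card': "card (\<sigma> \<union> {p, q}) = d"
        using le card by simp
      have eq: "\<sigma>' - {r} = \<sigma>" "r \<in> \<sigma>'" "\<sigma>' \<subseteq> insert r (rays \<Delta>)" "\<not> {p, q} \<subseteq> \<sigma>'" "\<sigma>' \<inter> {p, q} \<noteq> {}"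
        using 2(1,2) r\<sigma> sub meet distinct by auto
      show ?thesis
        using volume_off_diagonal[OF eq(3,4)] eq is_volumeD(4)[OF vol 2(3) card']
          subdivided_weight_new[OF fan r 2(3) card'] 2(1) by (auto simp: apply_op_at_mconst)
    qed
  qed
  ultimately show ?thesis
    using volume_forms unfolding is_volume_def rays by blast
qed

theorem theorem1p5:
  fixes \<Delta> :: "('v, 'n::finite) fan" and d :: nat and w :: "'v set \<Rightarrow> real" and p q r :: 'v
  assumes "simplicial_fan d \<Delta>"
    and "w \<in> minkowski_weights \<Delta> d"
    and "p \<noteq> q" and "{p, q} \<in> cones \<Delta>"
    and "r \<notin> rays \<Delta>"
  shows "subdivided_weight d \<Delta> p q r w \<in> minkowski_weights (star_subdivision \<Delta> p q r) d \<and>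
    (fps_const (mvar p) - fps_const (mvar q)) * D_op p q =
      fps_const (mvar p) * exp_z (mvar q) - fps_const (mvar q) * exp_z (mvar p) \<and>
    mixed_volume d (star_subdivision \<Delta> p q r) (subdivided_weight d \<Delta> p q r w) =
      apply_op_at (D_op p q) (mixed_volume d \<Delta> w) (mvar r - mvar p - mvar q)"
proof -
  obtain V where V: "is_volume d \<Delta> w V"
    using volume_exists[OF assms(1,2)] by blast
  have "mixed_volume d \<Delta> w = V"
    using simplicial_fan_complex[OF assms(1)] V
    by (intro mixed_volume_unique) (simp_all add: simplicial_linear_complex_def)
  moreover have "is_volume d (star_subdivision \<Delta> p q r) (subdivided_weight d \<Delta> p q r w)
      (apply_op_at (D_op p q) V (mvar r - mvar p - mvar q))"
    by (rule volume_star_subdivision[OF assms(1) V assms(3-5)])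
  moreover note star_subdivision_complex[OF assms(1,3,5)]
  \<comment> \<open>The equations for the substituted polynomial are used twice: they make the
    subdivided weight balanced and identify its mixed volume.\<close>
  ultimately show ?thesis
    using volume_imp_minkowski_weight mixed_volume_unique D_op_identity by metis
qed

end
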